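(* Let the sequences be generated by the HAP-PRS-SQP algorithm described in the context. Suppose that Assumptions 1 and 2 (stated in the context) hold. If $\hat L_\beta$ is a KL function, then $\sum_{k=0}^{+\infty}\|w_{k+1}-w_k\|<+\infty$. Furthermore, the sequence $\{w_k\}$ converges to a stationary point $w_*=(x_*,y_*,\lambda_* )$ of $L_\beta$ (i.e. $\nabla L_\beta(w_* )=0$), and $(x_*,y_* )$ is a KKT point of the problem $\min_{x,y}\{f(x)+g(y):Ax=y\}$.
   Context: Problem: $f:\mathbb{R}^{n_1}\to\mathbb{R}$ and $g:\mathbb{R}^{n_2}\to\mathbb{R}$ are continuously differentiable (not necessarily convex), $A\in\mathbb{R}^{n_2\times n_1}$; consider $\min_{x,y}\{f(x)+g(y):\ Ax=y\}$. For $\beta>0$ and $w=(x,y,\lambda)$, the augmented Lagrangian is $L_\beta(w)=f(x)+g(y)-\lambda^\top(Ax-y)+\frac{\beta}{2}\|Ax-y\|^2$. $(x_*,y_* )$ is a KKT point with multiplier $\lambda_*$ if $\nabla f(x_* )=A^\top\lambda_*$, $\nabla g(y_* )=-\lambda_*$, $Ax_*=y_*$ (equivalently $\nabla L_\beta(x_*,y_*,\lambda_* )=0$). For symmetric $S$, $\|x\|_S^2=x^\top Sx$; $\|\cdot\|$ is the Euclidean norm on vectors and the spectral norm on matrices; $\lambda_{\min},\lambda_{\max}$ denote extreme eigenvalues. HAP-PRS-SQP algorithm. Parameters: $\rho,\nu\in(0,1)$, $\alpha\in(-1,\frac1\rho-1)$, $\beta,\ell,\sigma>0$, $r,s\in\mathbb{R}$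 with $r+s\neq0$; starting point $w_0=(x_0,y_0,\lambda_0)$. $H_k^x\in\mathbb{R}^{n_1\times n_1}$ and $H_k^y\in\mathbb{R}^{n_2\times n_2}$ are symmetric ($H_0^x,H_0^y$ positive definite) with $\mathcal{H}_k^x:=H_k^x+\beta A^\top A+\ell I\succ0$ and $\mathcal{H}_k^y:=H_k^y+(\beta+\sigma)I\succ0$ for all $k$. For $k=0,1,2,\dots$: (1) $\tilde x_{k+1}=\arg\min_x\{\nabla f(x_k)^\top(x-x_k)+\frac12\|x-x_k\|^2_{H_k^x}-\lambda_k^\top(Ax-y_k)+\frac\beta2\|Ax-y_k\|^2+\frac\ell2\|x-x_k\|^2\}$; $\bar x_{k+1}=\tilde x_{k+1}+\alpha(\tilde x_{k+1}-x_k)$; $d_k^x=\bar x_{k+1}-x_k$; $t_k^x=\nu^{i}$ with $i$ the smallest nonnegative integer such that $L_\beta(x_k+\nu^i d_k^x,y_k,\lambda_k)\le L_\beta(x_k,y_k,\lambda_k)-\rho\nu^i\|d_k^x\|^2_{\mathcal{H}_k^x}$; $x_{k+1}=x_k+t_k^xd_k^x$. (2) $\lambda_{k+\frac12}=\lambda_k-r\beta(Ax_{k+1}-y_k)$. (3) $\tilde y_{k+1}=\arg\min_y\{\nabla g(y_k)^\top(y-y_k)+\frac12\|y-y_k\|^2_{H_k^y}-\lambda_{k+\frac12}^\top(Ax_{k+1}-y)+\frac\beta2\|Ax_{k+1}-y\|^2+\frac\sigma2\|y-y_k\|^2\}$; $\bar y_{k+1}=\tilde y_{k+1}+\alpha(\tilde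 y_{k+1}-y_k)$; $d_k^y=\bar y_{k+1}-y_k$; $t_k^y=\nu^i$ with $i$ the smallest nonnegative integer such that $L_\beta(x_{k+1},y_k+\nu^id_k^y,\lambda_{k+\frac12})\le L_\beta(x_{k+1},y_k,\lambda_{k+\frac12})-\rho\nu^i\|d_k^y\|^2_{\mathcal{H}_k^y}$; $y_{k+1}=y_k+t_k^yd_k^y$. (4) $\lambda_{k+1}=\lambda_{k+\frac12}-s\beta(Ax_{k+1}-y_{k+1})$, $w_{k+1}=(x_{k+1},y_{k+1},\lambda_{k+1})$. (The algorithm stops when $w_{k+1}=w_k$; the sequences here are the infinite ones obtained by running without the stopping test.) Assumption 1: (i) $\{w_k\}$ is bounded, and $\|H_k^x\|\le\eta^x$, $\|H_k^y\|\le\eta^y$ for all $k$. (ii) There are lower bounds $\underline\lambda^x$ of $\{\lambda_{\min}(H_k^x)\}$ and $\underline\lambda^y$ of $\{\lambda_{\min}(H_k^y)\}$ such that $\eta_1^x:=\underline\lambda^x+\beta\lambda_{\min}(A^\top A)+\ell>0$ and $\eta_1^y:=\underline\lambda^y+\beta+\sigma>0$. (iii) $\nabla f$ and $\nabla g$ are locally Lipschitz continuous. Constants: $\eta_2^y:=\eta^y+\beta+\sigma$. Let $\mathcal{S}^x\subset\mathbb{R}^{n_1}$, $\mathcal{S}^y\subset\mathbb{R}^{n_2}$ be compact sets with $x_k+td_k^x\in\mathcal{S}^x$, $y_k+td_k^y\in\mathcal{S}^y$ for all $t\in[0,1]$ and all $k$ (they exist under Assumption 1), and let $L_f,L_g>0$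 be Lipschitz constants of $\nabla f$ on $\mathcal{S}^x$ and of $\nabla g$ on $\mathcal{S}^y$. Set $$\gamma:=\nu\min\left\{1,\frac{(\frac{1}{1+\alpha}-\rho)\eta_1^{x}}{L_f+\beta\|A^{\top}A\|},\frac{(\frac{1}{1+\alpha}-\rho)\eta_1^y}{L_g+\beta}\right\},$$ $$\delta^y =\rho\gamma\eta^y_1 -\frac{6}{|r+s|\beta}\left(L_{g}^{2}+(1+s^{2})\beta^{2}+2\left(\frac{\eta_2^y}{1+\alpha}\right)^2\right)-\frac{|rs|\beta}{|r+s|},\quad \delta^x=\rho\gamma\eta^x_1-\frac{6(1-s)^2\beta\lambda_{\max}(A^{\top}A)}{|r+s|}.$$ Assumption 2: the parameters are chosen such that $\delta^x>0$ and $\delta^y>0$. Merit function: for $\hat w=(w,d^y)\in\mathbb{R}^{n_1}\times\mathbb{R}^{n_2}\times\mathbb{R}^{n_2}\times\mathbb{R}^{n_2}$, $\hat L_\beta(\hat w):=L_\beta(w)+\frac{6}{|r+s|\beta}\left(L_g^2+\beta^2+\left(\frac{\eta_2^y}{1+\alpha}\right)^2\right)\|d^y\|^2$. KL function: a continuously differentiable $q:\mathbb{R}^n\to\mathbb{R}$ has the KL property at $\bar x$ if there exist a neighborhood $U$ of $\bar x$, $\bar\sigma\in(0,\infty]$ and a continuous concave $\varphi:[0,\bar\sigma)\to\mathbb{R}_+$ with $\varphi(0)=0$, $\varphi$ continuously differentiable on $(0,\bar\sigma)$, $\varphi'>0$ on $(0,\bar\sigma)$, and $\varphi'(q(x)-q(\bar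 x))\|\nabla q(x)\|\ge1$ for all $x\in U$ with $q(\bar x)<q(x)<q(\bar x)+\bar\sigma$. $q$ is a KL function if it has the KL property at every point. *)

theory Defs
  imports "HOL-Analysis.Analysis"
begin

definition grad :: "('a::real_inner \<Rightarrow> real) \<Rightarrow> 'a \<Rightarrow> 'a" where
  "grad q x = (THE D. GDERIV q x :> D)"

lemma grad_eqI:
  assumes "GDERIV q x :> D"
  shows "grad q x = D"
  unfolding grad_def
proof (rule the_equality[where P = "\<lambda>D. GDERIV q x :> D", OF assms])
  fix E assume "GDERIV q x :> E"
  then have "(\<lambda>h. h \<bullet> E) = (\<lambda>h. h \<bullet> D)"
    using assms unfolding gderiv_def by (rule has_derivative_unique)
  then have "h \<bullet> E = h \<bullet> D" for h
    by (rule fun_cong)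
  then show "E = D"
    using vector_eq_ldot by blast
qed

definition C1_fun :: "('a::real_inner \<Rightarrow> real) \<Rightarrow> bool" where
  "C1_fun q \<longleftrightarrow> (\<forall>x. GDERIV q x :> grad q x) \<and> continuous_on UNIV (grad q)"

definition locally_lipschitz :: "('a::metric_space \<Rightarrow> 'b::metric_space) \<Rightarrow> bool" where
  "locally_lipschitz F \<longleftrightarrow> (\<forall>x. \<exists>u>0. \<exists>L. L-lipschitz_on (ball x u) F)"

definition eigenvalue :: "real^'n^'n \<Rightarrow> real \<Rightarrow> bool" where
  "eigenvalue S \<mu> \<longleftrightarrow> (\<exists>v. v \<noteq> 0 \<and> S *v v = \<mu> *\<^sub>R v)"

text \<open>Only meaningful for matrices that have a real eigenvalue, such as symmetric ones.\<close>

definition lambda_min :: "real^'n^'n \<Rightarrow> real" where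
  "lambda_min S = (LEAST \<mu>. eigenvalue S \<mu>)"

definition lambda_max :: "real^'n^'n \<Rightarrow> real" where
  "lambda_max S = (GREATEST \<mu>. eigenvalue S \<mu>)"

definition spectral_norm :: "real^'n^'m \<Rightarrow> real" where
  "spectral_norm M = onorm ((*v) M)"

definition wnorm2 :: "real^'n^'n \<Rightarrow> real^'n \<Rightarrow> real" where
  "wnorm2 S v = v \<bullet> (S *v v)"

definition symmetric_mat :: "real^'n^'n \<Rightarrow> bool" where
  "symmetric_mat S \<longleftrightarrow> transpose S = S"

definition pos_def :: "real^'n^'n \<Rightarrow> bool" where
  "pos_def S \<longleftrightarrow> symmetric_mat S \<and> (\<forall>v. v \<noteq> 0 \<longrightarrow> 0 < wnorm2 S v)"

fun aug_lag :: "(real^'n1 \<Rightarrow> real) \<Rightarrow> (real^'n2 \<Rightarrow> real) \<Rightarrow> real^'n1^'n2 \<Rightarrow> real \<Rightarrow>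
    (real^'n1) \<times> (real^'n2) \<times> (real^'n2) \<Rightarrow> real" where
  "aug_lag f g A \<beta> (x, y, lam) =
     f x + g y - lam \<bullet> (A *v x - y) + \<beta> / 2 * (norm (A *v x - y))\<^sup>2"

definition KKT_point :: "(real^'n1 \<Rightarrow> real) \<Rightarrow> (real^'n2 \<Rightarrow> real) \<Rightarrow> real^'n1^'n2 \<Rightarrow>
    real^'n1 \<Rightarrow> real^'n2 \<Rightarrow> real^'n2 \<Rightarrow> bool" where
  "KKT_point f g A x y lam \<longleftrightarrow>
     grad f x = transpose A *v lam \<and> grad g y = - lam \<and> A *v x = y"

definition x_subproblem :: "(real^'n1 \<Rightarrow> real) \<Rightarrow> real^'n1^'n2 \<Rightarrow> real \<Rightarrow> real \<Rightarrow> real^'n1^'n1 \<Rightarrow>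
    real^'n1 \<Rightarrow> real^'n2 \<Rightarrow> real^'n2 \<Rightarrow> real^'n1 \<Rightarrow> real" where
  "x_subproblem f A \<beta> l H xk yk lam x =
     grad f xk \<bullet> (x - xk) + 1/2 * wnorm2 H (x - xk) - lam \<bullet> (A *v x - yk)
     + \<beta> / 2 * (norm (A *v x - yk))\<^sup>2 + l / 2 * (norm (x - xk))\<^sup>2"

text \<open>Here \<open>xn\<close> is the already updated first block and \<open>lam\<close> the intermediate multiplier.\<close>

definition y_subproblem :: "(real^'n2 \<Rightarrow> real) \<Rightarrow> real^'n1^'n2 \<Rightarrow> real \<Rightarrow> real \<Rightarrow> real^'n2^'n2 \<Rightarrow>
    real^'n1 \<Rightarrow> real^'n2 \<Rightarrow> real^'n2 \<Rightarrow> real^'n2 \<Rightarrow> real" where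
  "y_subproblem g A \<beta> \<sigma> H xn yk lam y =
     grad g yk \<bullet> (y - yk) + 1/2 * wnorm2 H (y - yk) - lam \<bullet> (A *v xn - y)
     + \<beta> / 2 * (norm (A *v xn - y))\<^sup>2 + \<sigma> / 2 * (norm (y - yk))\<^sup>2"

fun merit :: "(real^'n1 \<Rightarrow> real) \<Rightarrow> (real^'n2 \<Rightarrow> real) \<Rightarrow> real^'n1^'n2 \<Rightarrow> real \<Rightarrow>
    real \<Rightarrow> real \<Rightarrow> real \<Rightarrow> real \<Rightarrow> real \<Rightarrow>
    ((real^'n1) \<times> (real^'n2) \<times> (real^'n2)) \<times> (real^'n2) \<Rightarrow> real" where
  "merit f g A \<beta> r s \<alpha> Lg \<eta>2y (w, dy) =
     aug_lag f g A \<beta> w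
     + 6 / (\<bar>r + s\<bar> * \<beta>) * (Lg\<^sup>2 + \<beta>\<^sup>2 + (\<eta>2y / (1 + \<alpha>))\<^sup>2) * (norm dy)\<^sup>2"

definition KL_property :: "('a::real_inner \<Rightarrow> real) \<Rightarrow> 'a \<Rightarrow> bool" where
  "KL_property q xb \<longleftrightarrow>
     (\<exists>U (c::ereal) \<phi> \<phi>'.
        xb \<in> interior U \<and> 0 < c \<and>
        continuous_on {t. 0 \<le> t \<and> ereal t < c} \<phi> \<and>
        concave_on {t. 0 \<le> t \<and> ereal t < c} \<phi> \<and>
        (\<forall>t. 0 \<le> t \<and> ereal t < c \<longrightarrow> 0 \<le> \<phi> t) \<and>
        \<phi> 0 = 0 \<and>
        (\<forall>t. 0 < t \<and> ereal t < c \<longrightarrow> (\<phi> has_real_derivative \<phi>' t) (at t)) \<and>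
        continuous_on {t. 0 < t \<and> ereal t < c} \<phi>' \<and>
        (\<forall>t. 0 < t \<and> ereal t < c \<longrightarrow> 0 < \<phi>' t) \<and>
        (\<forall>x\<in>U. q xb < q x \<and> ereal (q x) < ereal (q xb) + c \<longrightarrow>
           1 \<le> \<phi>' (q x - q xb) * norm (grad q x)))"

definition KL_function :: "('a::real_inner \<Rightarrow> real) \<Rightarrow> bool" where
  "KL_function q \<longleftrightarrow> C1_fun q \<and> (\<forall>x. KL_property q x)"

end

theory Submission
  imports Defs
begin

text \<open>
  Write $a_k = \|d_k^x\| + \|d_k^y\|$ and $\hat w_k = (w_{k+1}, d_k^y)$. The optimality conditions of
  the two subproblems express the partial gradients of $L_\beta$ through $d_k^x$ and $d_k^y$, so the
  line searches accept a step size at least $\gamma$. With $u = A x_{k+1} - y_k$ and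
  $v = A x_{k+1} - y_{k+1}$, the two multiplier updates raise $L_\beta$ by
  $\beta (r \|u\|^2 + s \|v\|^2) = \beta (\|r u + s v\|^2 + r s \|u - v\|^2) / (r + s)$, where
  $\lambda_{k+1} - \lambda_k = - \beta (r u + s v)$ is controlled by $d_k^x$, $d_k^y$ and $d_{k-1}^y$
  through the optimality condition in $y$. The merit function absorbs the term in $d_{k-1}^y$; hence
  $\hat L_\beta(\hat w_{k+1}) + \delta a_{k+1}^2 \le \hat L_\beta(\hat w_k)$, while
  $\|\nabla \hat L_\beta(\hat w_k)\|$ and $\|\hat w_{k+1} - \hat w_k\|$ are bounded by
  $C (a_{k+1} + a_k)$. The KL inequality at one cluster point then traps the sequence near that point
  and makes $a$ summable.
\<close>

section \<open>Extreme eigenvalues of symmetric matrices\<close>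

text \<open>First-order optimality without derivatives: when a function is exactly quadratic along a
  line and minimal at 0, its linear coefficient vanishes. It serves both the Rayleigh quotient and
  the two subproblems.\<close>

lemma linear_coeff_zero_if_quadratic_nonneg:
  fixes b c :: real
  assumes "\<And>t. 0 \<le> t * b + t\<^sup>2 * c"
  shows "b = 0"
proof (rule ccontr)
  assume "b \<noteq> 0"
  \<comment> \<open>A step against the sign of \<open>b\<close>. Dividing by
    \<open>\<bar>c\<bar> + 1\<close> keeps the denominator positive for every \<open>c\<close> and
    lets the linear term outweigh the quadratic one.\<close>
  define t where "t = - b / (\<bar>c\<bar> + 1)"
  have "t * b + t\<^sup>2 * c = b\<^sup>2 * (c - (\<bar>c\<bar> + 1)) / (\<bar>c\<bar> + 1)\<^sup>2"
    unfolding t_def by (simp add: divide_simps) (simp add: power2_eq_square algebra_simps)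
  also have "\<dots> < 0"
    using \<open>b \<noteq> 0\<close> by (intro divide_neg_pos mult_pos_neg) auto
  finally show False
    using assms[of t] by simp
qed

lemma inner_transpose_matrix_vector:
  fixes A :: "real^'n^'m"
  shows "u \<bullet> (transpose A *v v) = (A *v u) \<bullet> v"
  by (metis dot_lmul_matrix inner_commute transpose_matrix_vector)

lemma symmetric_mat_inner:
  assumes "symmetric_mat S"
  shows "(S *v u) \<bullet> v = u \<bullet> (S *v v)"
  using assms inner_transpose_matrix_vector[of u S v] by (simp add: symmetric_mat_def)

lemma wnorm2_add_scaled:
  assumes "symmetric_mat S"
  shows "wnorm2 S (v + t *\<^sub>R u) = wnorm2 S v + t * (2 * (u \<bullet> (S *v v))) + t\<^sup>2 * wnorm2 S u"
  using symmetric_mat_inner[OF assms, of v u]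
  by (simp add: wnorm2_def matrix_vector_right_distrib matrix_vector_mult_scaleR inner_simps
      power2_eq_square algebra_simps inner_commute)

lemma norm_add_scaled_sq:
  fixes u v :: "'a::real_inner"
  shows "(norm (v + t *\<^sub>R u))\<^sup>2 = (norm v)\<^sup>2 + t * (2 * (u \<bullet> v)) + t\<^sup>2 * (norm u)\<^sup>2"
  unfolding power2_norm_eq_inner by (simp add: inner_simps power2_eq_square algebra_simps inner_commute)

lemma wnorm2_scaleR: "wnorm2 S (t *\<^sub>R u) = t\<^sup>2 * wnorm2 S u"
  by (simp add: wnorm2_def matrix_vector_mult_scaleR power2_eq_square)

lemma wnorm2_gram: "wnorm2 (transpose A ** A) v = (norm (A *v v))\<^sup>2"
  unfolding wnorm2_def matrix_vector_mul_assoc[symmetric] inner_transpose_matrix_vector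
  by (simp add: power2_norm_eq_inner)

lemma symmetric_mat_gram: "symmetric_mat (transpose A ** A)"
  by (simp add: symmetric_mat_def matrix_transpose_mul)

lemma eigenvalue_rayleigh:
  assumes "v \<noteq> 0" "S *v v = \<mu> *\<^sub>R v"
  shows "wnorm2 S v = \<mu> * (norm v)\<^sup>2"
  using assms by (simp add: wnorm2_def power2_norm_eq_inner)

text \<open>The quadratic form attains its minimum on the unit sphere by compactness, and
  homogeneity extends the bound to all vectors. The minimiser \<open>v\<close> is an eigenvector
  because perturbing it cannot lower the form below \<open>\<mu>\<close> times the squared
  norm.\<close>

lemma symmetric_mat_least_eigenvalue:
  fixes S :: "real^'n^'n"
  assumes S: "symmetric_mat S"
  obtains \<mu> where "eigenvalue S \<mu>" "\<And>u. \<mu> * (norm u)\<^sup>2 \<le> wnorm2 S u"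
proof -
  have cont: "continuous_on (sphere 0 1) (wnorm2 S)"
    unfolding wnorm2_def by (intro continuous_intros matrix_vector_mult_linear_continuous_on)
  have "sphere 0 1 \<noteq> ({} :: (real^'n) set)" by simp
  then obtain v where v: "norm v = 1"
      and min: "\<And>u. norm u = 1 \<Longrightarrow> wnorm2 S v \<le> wnorm2 S u"
    using continuous_attains_inf[OF compact_sphere _ cont] by auto
  define \<mu> where "\<mu> = wnorm2 S v"
  have lower: "\<mu> * (norm u)\<^sup>2 \<le> wnorm2 S u" for u
  proof (cases "u = 0")
    case False
    have "\<mu> \<le> wnorm2 S ((1 / norm u) *\<^sub>R u)"
      unfolding \<mu>_def using False by (intro min) simp
    then show ?thesis
      using False by (simp add: wnorm2_scaleR field_simps)
  qed (simp add: wnorm2_def)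
  \<comment> \<open>Perturbing \<open>v\<close> along the residual of the eigenvalue equation makes
    the first-order coefficient equal to \<open>2 * (e \<bullet> e)\<close>, so its vanishing gives
    \<open>e = 0\<close>.\<close>
  define e where "e = S *v v - \<mu> *\<^sub>R v"
  have "0 \<le> t * (2 * (e \<bullet> e)) + t\<^sup>2 * (wnorm2 S e - \<mu> * (norm e)\<^sup>2)" for t
  proof -
    have "(norm (v + t *\<^sub>R e))\<^sup>2 = 1 + t * (2 * (e \<bullet> v)) + t\<^sup>2 * (norm e)\<^sup>2"
      using v by (simp add: norm_add_scaled_sq)
    then have "\<mu> * (1 + t * (2 * (e \<bullet> v)) + t\<^sup>2 * (norm e)\<^sup>2)
        \<le> \<mu> + t * (2 * (e \<bullet> (S *v v))) + t\<^sup>2 * wnorm2 S e"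
      using lower[of "v + t *\<^sub>R e"] wnorm2_add_scaled[OF S] by (simp add: \<mu>_def)
    moreover have ee: "e \<bullet> e = e \<bullet> (S *v v) - \<mu> * (e \<bullet> v)"
      by (simp add: e_def inner_simps)
    ultimately show ?thesis
      unfolding ee by (simp add: algebra_simps)
  qed
  then have "2 * (e \<bullet> e) = 0"
    by (rule linear_coeff_zero_if_quadratic_nonneg)
  then have "S *v v = \<mu> *\<^sub>R v"
    by (simp add: e_def)
  then have "eigenvalue S \<mu>"
    unfolding eigenvalue_def using v by (intro exI[of _ v]) auto
  then show thesis
    using lower that by blast
qed

text \<open>The Rayleigh minimum is itself an eigenvalue and lies below all others, so the
  \<open>LEAST\<close> in \<open>lambda_min\<close> is attained and equals it.\<close>

lemma lambda_min_le_rayleigh: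
  assumes "symmetric_mat S"
  shows "lambda_min S * (norm u)\<^sup>2 \<le> wnorm2 S u"
proof -
  obtain \<mu> where ev: "eigenvalue S \<mu>" and lower: "\<And>u. \<mu> * (norm u)\<^sup>2 \<le> wnorm2 S u"
    using symmetric_mat_least_eigenvalue[OF assms] by blast
  have "\<mu> \<le> \<kappa>" if \<kappa>: "eigenvalue S \<kappa>" for \<kappa>
  proof -
    obtain v where "v \<noteq> 0" "S *v v = \<kappa> *\<^sub>R v"
      using \<kappa> by (auto simp: eigenvalue_def)
    then show ?thesis
      using lower[of v] eigenvalue_rayleigh[of v S \<kappa>] by simp
  qed
  then have "lambda_min S = \<mu>"
    unfolding lambda_min_def using ev by (intro Least_equality)
  then show ?thesis
    using lower by simp
qed

text \<open>The largest eigenvalue of \<open>S\<close> is the negated least eigenvalue of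
  \<open>- S\<close>.\<close>

lemma rayleigh_le_lambda_max:
  fixes S :: "real^'n^'n"
  assumes "symmetric_mat S"
  shows "wnorm2 S u \<le> lambda_max S * (norm u)\<^sup>2"
proof -
  have minus: "(- S) *v u = - (S *v u)" for u
    using matrix_vector_mult_diff_rdistrib[of 0 S u] by simp
  have "symmetric_mat (- S)"
    using assms by (simp add: symmetric_mat_def transpose_def vec_eq_iff)
  then obtain \<mu> where \<mu>: "eigenvalue (- S) \<mu>" and lower: "\<And>u. \<mu> * (norm u)\<^sup>2 \<le> wnorm2 (- S) u"
    using symmetric_mat_least_eigenvalue by blast
  have upper: "wnorm2 S u \<le> - \<mu> * (norm u)\<^sup>2" for u
    using lower[of u] by (simp add: wnorm2_def minus)
  have ev: "eigenvalue S (- \<mu>)"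
    using \<mu> unfolding eigenvalue_def minus by (auto simp: minus_equation_iff[of "S *v _"])
  have "\<kappa> \<le> - \<mu>" if \<kappa>: "eigenvalue S \<kappa>" for \<kappa>
  proof -
    obtain v where "v \<noteq> 0" "S *v v = \<kappa> *\<^sub>R v"
      using \<kappa> by (auto simp: eigenvalue_def)
    then show ?thesis
      using upper[of v] eigenvalue_rayleigh[of v S \<kappa>]
      by (metis mult_le_cancel_right_pos zero_less_norm_iff zero_less_power)
  qed
  then have "lambda_max S = - \<mu>"
    unfolding lambda_max_def using ev by (intro Greatest_equality)
  then show ?thesis
    using upper by simp
qed

lemma norm_matrix_vector_le_spectral_norm: "norm (M *v v) \<le> spectral_norm M * norm v"
  unfolding spectral_norm_def by (intro onorm matrix_vector_mul_bounded_linear)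

lemma spectral_norm_nonneg: "0 \<le> spectral_norm M"
  unfolding spectral_norm_def by (intro onorm_pos_le matrix_vector_mul_bounded_linear)

text \<open>Cauchy-Schwarz applied to \<open>v\<close> and its image under the Gram matrix. This
  gives the constant of the penalty term in the form in which it occurs in \<gamma>.\<close>

lemma norm_matrix_vector_sq_le: "(norm (A *v v))\<^sup>2 \<le> spectral_norm (transpose A ** A) * (norm v)\<^sup>2"
proof -
  have "(norm (A *v v))\<^sup>2 = v \<bullet> ((transpose A ** A) *v v)"
    by (metis wnorm2_gram wnorm2_def)
  also have "\<dots> \<le> norm v * norm ((transpose A ** A) *v v)"
    by (rule norm_cauchy_schwarz)
  also have "\<dots> \<le> norm v * (spectral_norm (transpose A ** A) * norm v)"
    by (intro mult_left_mono norm_matrix_vector_le_spectral_norm norm_ge_zero)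
  finally show ?thesis
    by (simp add: power2_eq_square mult_ac)
qed

section \<open>Line search\<close>

text \<open>The mean value theorem loses the usual factor 1/2, which the step size bound \<open>\<gamma>\<close> does not
  need.\<close>

lemma lipschitz_grad_upper_bound:
  fixes f :: "'a::real_inner \<Rightarrow> real"
  assumes f: "C1_fun f" and lip: "L-lipschitz_on S (grad f)"
    and seg: "\<And>t. t \<in> {0..1} \<Longrightarrow> x + t *\<^sub>R d \<in> S" and t: "t \<in> {0..1}"
  shows "f (x + t *\<^sub>R d) \<le> f x + t * (d \<bullet> grad f x) + L * t\<^sup>2 * (norm d)\<^sup>2"
proof (cases "t = 0")
  case False
  have "((\<lambda>\<tau>. f (x + \<tau> *\<^sub>R d)) has_derivative (\<lambda>h. h * (d \<bullet> grad f (x + \<tau> *\<^sub>R d)))) (at \<tau>)" for \<tau>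
  proof -
    have f': "(f has_derivative (\<lambda>h. h \<bullet> grad f (x + \<tau> *\<^sub>R d))) (at (x + \<tau> *\<^sub>R d))"
      using f by (simp add: C1_fun_def gderiv_def)
    have line: "((\<lambda>\<tau>. x + \<tau> *\<^sub>R d) has_derivative (\<lambda>h. h *\<^sub>R d)) (at \<tau>)"
      by (auto intro!: derivative_eq_intros)
    show ?thesis
      using has_derivative_compose[OF line, of f "\<lambda>h. h \<bullet> grad f (x + \<tau> *\<^sub>R d)", OF f'] by simp
  qed
  then have "\<exists>\<tau>\<in>{0..t}. f (x + t *\<^sub>R d) - f (x + 0 *\<^sub>R d) = (t - 0) * (d \<bullet> grad f (x + \<tau> *\<^sub>R d))"
    using t mvt_very_simple[of 0 t "\<lambda>\<tau>. f (x + \<tau> *\<^sub>R d)" "\<lambda>\<tau> h. h * (d \<bullet> grad f (x + \<tau> *\<^sub>R d))"]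
    by (simp add: has_derivative_at_withinI)
  then obtain \<tau> where \<tau>: "0 \<le> \<tau>" "\<tau> \<le> t"
      and eq: "f (x + t *\<^sub>R d) = f x + t * (d \<bullet> grad f (x + \<tau> *\<^sub>R d))"
    by auto
  have L: "0 \<le> L" using lip by (rule lipschitz_on_nonneg)
  have "norm (grad f (x + \<tau> *\<^sub>R d) - grad f x) \<le> L * (\<tau> * norm d)"
    using lipschitz_onD[OF lip, of "x + \<tau> *\<^sub>R d" x] seg[of 0] seg[of \<tau>] \<tau> t
    by (simp add: dist_norm)
  also have "\<dots> \<le> L * (t * norm d)"
    using L \<tau> by (intro mult_left_mono mult_right_mono) auto
  finally have "d \<bullet> (grad f (x + \<tau> *\<^sub>R d) - grad f x) \<le> norm d * (L * (t * norm d))"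
    by (meson norm_cauchy_schwarz mult_left_mono norm_ge_zero order_trans)
  then have "t * (d \<bullet> grad f (x + \<tau> *\<^sub>R d)) \<le> t * (d \<bullet> grad f x + norm d * (L * (t * norm d)))"
    using t by (intro mult_left_mono) (auto simp: inner_diff_right)
  then show ?thesis
    unfolding eq by (simp add: power2_eq_square algebra_simps)
qed simp

text \<open>Common to both blocks: \<open>Q\<close> stands for the weighted and \<open>N\<close> for
  the plain squared norm of the direction. The quadratic model accepts every trial step below a
  threshold, so backtracking terminates and overshoots that threshold by at most one factor
  \<nu>.\<close>

lemma armijo_backtracking:
  fixes F :: "'a::real_vector \<Rightarrow> real"
  assumes upper: "\<And>t. t \<in> {0..1} \<Longrightarrow> F (x + t *\<^sub>R d) \<le> F x - t * (\<kappa> * Q) + t\<^sup>2 * (M * N)"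
    and "0 < M" "0 \<le> N" "0 < \<eta>" "\<eta> * N \<le> Q" "\<rho> < \<kappa>" "0 < \<nu>" "\<nu> < 1"
    and t: "t = \<nu> ^ (LEAST i. F (x + \<nu>^i *\<^sub>R d) \<le> F x - \<rho> * \<nu>^i * Q)"
  shows "0 < t" "t \<le> 1" "F (x + t *\<^sub>R d) \<le> F x - \<rho> * t * Q"
    "\<nu> * min 1 ((\<kappa> - \<rho>) * \<eta> / M) \<le> t"
proof -
  \<comment> \<open>For a step at most \<open>m\<close>, the quadratic term of the model is at most
    the surplus \<open>(\<kappa> - \<rho>) * Q\<close> per unit step.\<close>
  define m where "m = min 1 ((\<kappa> - \<rho>) * \<eta> / M)"
  have m: "0 < m" "m \<le> 1" "m * M \<le> (\<kappa> - \<rho>) * \<eta>"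
    using assms by (auto simp: m_def field_simps min_def)
  define P where "P i \<longleftrightarrow> F (x + \<nu>^i *\<^sub>R d) \<le> F x - \<rho> * \<nu>^i * Q" for i
  have P: "P i" if "\<nu>^i \<le> m" for i
  proof -
    have "\<nu>^i * M * N \<le> m * M * N"
      using that assms by (intro mult_right_mono) auto
    also have "\<dots> \<le> (\<kappa> - \<rho>) * \<eta> * N"
      using m(3) \<open>0 \<le> N\<close> by (rule mult_right_mono)
    also have "\<dots> \<le> (\<kappa> - \<rho>) * Q"
      using assms by (simp add: mult.assoc)
    finally have "\<nu>^i * (\<nu>^i * M * N) \<le> \<nu>^i * ((\<kappa> - \<rho>) * Q)"
      using assms by (intro mult_left_mono) auto
    moreover have "F (x + \<nu>^i *\<^sub>R d) \<le> F x - \<nu>^i * (\<kappa> * Q) + (\<nu>^i)\<^sup>2 * (M * N)"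
      using assms by (intro upper) (auto intro: power_le_one)
    ultimately show ?thesis
      unfolding P_def by (simp add: power2_eq_square algebra_simps)
  qed
  obtain i0 where "\<nu>^i0 < m"
    using real_arch_pow_inv[OF m(1) \<open>\<nu> < 1\<close>] by blast
  then have "P (LEAST i. P i)"
    using P by (intro LeastI[of P i0]) simp
  moreover have t': "t = \<nu> ^ (LEAST i. P i)"
    by (simp add: t P_def)
  ultimately show "F (x + t *\<^sub>R d) \<le> F x - \<rho> * t * Q"
    by (simp add: P_def)
  show "0 < t" "t \<le> 1"
    unfolding t using assms by (auto intro: power_le_one)
  show "\<nu> * min 1 ((\<kappa> - \<rho>) * \<eta> / M) \<le> t"
  proof (cases "LEAST i. P i")
    case 0
    then show ?thesis
      using t' m \<open>0 < \<nu>\<close> \<open>\<nu> < 1\<close> by (simp flip: m_def) (simp add: mult_le_one)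
  next
    \<comment> \<open>The exponent before the accepted one was rejected, hence its step exceeds
      \<open>m\<close>; the accepted step is \<nu> times that one.\<close>
    case (Suc j)
    then have "\<not> P j"
      using not_less_Least[of j P] by simp
    then have "m < \<nu>^j"
      using P by force
    then show ?thesis
      using t' Suc \<open>0 < \<nu>\<close> by (simp flip: m_def)
  qed
qed

section \<open>Finite length under the KL inequality\<close>

text \<open>A working form of the KL property: a ball replaces the neighbourhood, a finite real
  \<open>c\<close> replaces the possibly infinite bound, and concavity is recorded as the tangent
  inequality.\<close>

lemma KL_propertyE:
  fixes q :: "'a::real_inner \<Rightarrow> real"
  assumes "KL_property q p"
  obtains \<epsilon> c \<phi> \<phi>' where "0 < \<epsilon>" "0 < (c::real)" "continuous_on {0..<c} \<phi>"
    "\<phi> 0 = 0" "\<forall>t\<in>{0..<c}. 0 \<le> \<phi> t" "\<forall>t\<in>{0<..<c}. 0 < \<phi>' t"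
    "\<forall>t\<in>{0<..<c}. \<forall>u\<in>{0..<c}. \<phi> u \<le> \<phi> t + \<phi>' t * (u - t)"
    "\<forall>x. dist p x < \<epsilon> \<longrightarrow> q p < q x \<longrightarrow> q x < q p + c \<longrightarrow> 1 \<le> \<phi>' (q x - q p) * norm (grad q x)"
proof -
  obtain U and ce :: ereal and \<phi> \<phi>' where U: "p \<in> interior U" and ce: "0 < ce"
    and cont: "continuous_on {t. 0 \<le> t \<and> ereal t < ce} \<phi>"
    and conc: "concave_on {t. 0 \<le> t \<and> ereal t < ce} \<phi>"
    and nonneg: "\<forall>t. 0 \<le> t \<and> ereal t < ce \<longrightarrow> 0 \<le> \<phi> t" and zero: "\<phi> 0 = 0"
    and deriv: "\<forall>t. 0 < t \<and> ereal t < ce \<longrightarrow> (\<phi> has_real_derivative \<phi>' t) (at t)"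
    and pos: "\<forall>t. 0 < t \<and> ereal t < ce \<longrightarrow> 0 < \<phi>' t"
    and ineq: "\<forall>x\<in>U. q p < q x \<and> ereal (q x) < ereal (q p) + ce \<longrightarrow>
           1 \<le> \<phi>' (q x - q p) * norm (grad q x)"
    using assms unfolding KL_property_def by (elim exE conjE) (rule that; assumption)
  obtain \<epsilon> where \<epsilon>: "0 < \<epsilon>" "ball p \<epsilon> \<subseteq> U"
    using U by (meson mem_interior)
  obtain c where c: "0 < c" "ereal c \<le> ce"
    using ce by (metis ereal_dense2 ereal_less(2) less_imp_le)
  have below: "ereal t < ce" if "t < c" for t
    using that c by (metis ereal_less_eq(3) le_less_trans less_le_not_le linorder_not_le)
  have sub: "{0..<c} \<subseteq> {t. 0 \<le> t \<and> ereal t < ce}"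
    using below by auto
  have convex: "convex_on {0..<c} (\<lambda>t. - \<phi> t)"
    using conc sub unfolding concave_on_def by (rule convex_on_subset) simp
  show thesis
  proof (rule that[of \<epsilon> c \<phi> \<phi>'])
    show "\<forall>t\<in>{0<..<c}. \<forall>u\<in>{0..<c}. \<phi> u \<le> \<phi> t + \<phi>' t * (u - t)"
    proof (intro ballI)
      fix t u assume t: "t \<in> {0<..<c}" and u: "u \<in> {0..<c}"
      have "- \<phi>' t * (u - t) \<le> - \<phi> u - - \<phi> t"
      proof (rule convex_on_imp_above_tangent[OF convex])
        show "t \<in> interior {0..<c}" using t by simp
        show "((\<lambda>t. - \<phi> t) has_real_derivative - \<phi>' t) (at t within {0..<c})"
          by (rule has_field_derivative_at_within, rule DERIV_minus) (use t deriv below in auto)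
      qed (use u in auto)
      then show "\<phi> u \<le> \<phi> t + \<phi>' t * (u - t)" by simp
    qed
  next
    show "\<forall>x. dist p x < \<epsilon> \<longrightarrow> q p < q x \<longrightarrow> q x < q p + c \<longrightarrow> 1 \<le> \<phi>' (q x - q p) * norm (grad q x)"
    proof (intro allI impI)
      fix x assume x: "dist p x < \<epsilon>" "q p < q x" "q x < q p + c"
      have "ereal (q x) < ereal (q p) + ereal c"
        using x by simp
      also have "\<dots> \<le> ereal (q p) + ce"
        using c by (intro add_left_mono)
      finally show "1 \<le> \<phi>' (q x - q p) * norm (grad q x)"
        using x \<epsilon> ineq by auto
    qed
  next
    show "continuous_on {0..<c} \<phi>"
      using cont sub by (rule continuous_on_subset)
  qed (use \<epsilon> c zero nonneg pos below in auto)
qed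

text \<open>By the arithmetic-geometric mean inequality the square root of
  \<open>M * e * (a + b)\<close> is at most \<open>(a + b) / 4 + M * e\<close>. The weight 1/4 makes
  the coefficient 3 of \<open>a\<close> exceed the coefficient 1 of \<open>b\<close>, so summing
  over consecutive terms leaves twice the sum of the sequence.\<close>

lemma linear_step_from_quadratic:
  fixes a b e M :: real
  assumes "a\<^sup>2 \<le> M * e * (a + b)" "0 \<le> a" "0 \<le> b" "0 \<le> M * e"
  shows "3 * a \<le> b + 4 * M * e"
proof (rule ccontr)
  assume "\<not> 3 * a \<le> b + 4 * M * e"
  then have "((a + b) / 4 + M * e)\<^sup>2 < a\<^sup>2"
    using assms by (intro power_strict_mono) (auto simp: field_simps)
  moreover have "M * e * (a + b) \<le> ((a + b) / 4 + M * e)\<^sup>2"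
    using zero_le_power2[of "(a + b) / 4 - M * e"] by (simp add: power2_eq_square algebra_simps)
  ultimately show False
    using assms(1) by linarith
qed

text \<open>The KL argument detached from the algorithm. Descent makes the values along the whole
  sequence converge to \<open>q p\<close>, and the desingularising function turns the remaining
  decrease of the values into a telescoping bound on \<open>a\<close>. Two consecutive terms appear
  in the bounds because the multiplier step depends on the previous direction.\<close>

lemma KL_finite_length:
  fixes q :: "'a::real_inner \<Rightarrow> real" and z :: "nat \<Rightarrow> 'a" and a :: "nat \<Rightarrow> real"
  assumes KL: "KL_property q p" and cont: "isCont q p"
    and sub: "strict_mono \<theta>" "(z \<circ> \<theta>) \<longlonglongrightarrow> p"
    and a: "\<And>k. 0 \<le> a k" and pos: "0 < \<delta>" "0 \<le> C"
    and descent: "\<And>k. q (z (Suc k)) + \<delta> * (a (Suc k))\<^sup>2 \<le> q (z k)"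
    and grad: "\<And>k. norm (grad q (z k)) \<le> C * (a (Suc k) + a k)"
    and step: "\<And>k. norm (z (Suc k) - z k) \<le> C * (a (Suc k) + a k)"
  shows "summable a"
proof -
  have mono: "q (z (Suc k)) \<le> q (z k)" for k
    using descent[of k] pos by (smt (verit) mult_nonneg_nonneg zero_le_power2)
  have dec: "decseq (\<lambda>k. q (z k))"
    using mono by (rule decseq_SucI)
  have lim_sub: "(\<lambda>k. q (z (\<theta> k))) \<longlonglongrightarrow> q p"
    using isCont_tendsto_compose[OF cont sub(2)] by (simp add: comp_def)
  have lower: "q p \<le> q (z k)" for k
  proof (rule LIMSEQ_le_const2[OF lim_sub], intro exI allI impI)
    fix n assume "k \<le> n"
    then have "k \<le> \<theta> n" using seq_suble[OF sub(1), of n] by simp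
    then show "q (z (\<theta> n)) \<le> q (z k)" using dec by (auto simp: decseq_def)
  qed
  obtain m where m: "(\<lambda>k. q (z k)) \<longlonglongrightarrow> m"
    using decseq_convergent[OF dec, of "q p"] lower by blast
  then have "m = q p"
    using LIMSEQ_unique[OF lim_sub] LIMSEQ_subseq_LIMSEQ[OF m sub(1)] by (simp add: comp_def)
  then have lim: "(\<lambda>k. q (z k)) \<longlonglongrightarrow> q p"
    using m by simp
  show ?thesis
  \<comment> \<open>The KL inequality speaks only of points with value strictly above
    \<open>q p\<close>. If the limit value is reached, the values stay constant from there on, and
    descent forces \<open>a\<close> to vanish.\<close>
  proof (cases "\<exists>K. q (z K) = q p")
    case True
    then obtain K where K: "q (z K) = q p" by blast
    have const: "q (z k) = q p" if "K \<le> k" for k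
      using that dec lower[of k] K by (metis antisym decseqD)
    have "a (Suc k) = 0" if "K \<le> k" for k
      using descent[of k] const[of k] const[of "Suc k"] that pos
      by (simp add: mult_le_0_iff)
    then have "a k = 0" if "Suc K \<le> k" for k
      using that by (metis Suc_le_D Suc_le_mono)
    then show ?thesis
      by (intro summable_finite[of "{..K}"]) auto
  next
    case False
    then have above: "q p < q (z k)" for k
      using lower[of k] by (metis order_le_less)
    obtain \<epsilon> c \<phi> \<phi>' where \<epsilon>: "0 < \<epsilon>" and c: "0 < (c::real)" and \<phi>_cont: "continuous_on {0..<c} \<phi>"
      and \<phi>0: "\<phi> 0 = 0" and \<phi>_nonneg [rule_format]: "\<forall>t\<in>{0..<c}. 0 \<le> \<phi> t"
      and \<phi>'_pos [rule_format]: "\<forall>t\<in>{0<..<c}. 0 < \<phi>' t"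
      and tangent [rule_format]: "\<forall>t\<in>{0<..<c}. \<forall>u\<in>{0..<c}. \<phi> u \<le> \<phi> t + \<phi>' t * (u - t)"
      and ineq [rule_format]: "\<forall>x. dist p x < \<epsilon> \<longrightarrow> q p < q x \<longrightarrow> q x < q p + c \<longrightarrow>
            1 \<le> \<phi>' (q x - q p) * norm (grad q x)"
      by (rule KL_propertyE[OF KL]) (rule that; assumption)
    define \<Phi> where "\<Phi> k = \<phi> (q (z k) - q p)" for k
    define M where "M = C / \<delta>"
    have M: "0 \<le> M" using pos by (simp add: M_def)
    have "(\<lambda>k. q (z k) - q p) \<longlonglongrightarrow> q p - q p"
      by (intro tendsto_intros lim)
    then have lim0: "(\<lambda>k. q (z k) - q p) \<longlonglongrightarrow> 0"
      by simp
    then have ev_c: "\<forall>\<^sub>F k in sequentially. q (z k) - q p < c"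
      using c by (rule order_tendstoD)
    then have "\<forall>\<^sub>F k in sequentially. q (z k) - q p \<in> {0..<c}"
      using lower by (auto elim: eventually_mono)
    then have \<Phi>_lim: "\<Phi> \<longlonglongrightarrow> 0"
      using continuous_on_tendsto_compose[OF \<phi>_cont lim0] c \<phi>0 by (simp add: \<Phi>_def[abs_def])
    have "(\<lambda>k. (q (z k) - q (z (Suc k))) / \<delta>) \<longlonglongrightarrow> (q p - q p) / \<delta>"
      using pos by (intro tendsto_intros lim LIMSEQ_Suc) auto
    then have "(\<lambda>k. (q (z k) - q (z (Suc k))) / \<delta>) \<longlonglongrightarrow> 0"
      by simp
    moreover have "norm ((a (Suc k))\<^sup>2) \<le> (q (z k) - q (z (Suc k))) / \<delta>" for k
      using descent[of k] pos by (simp add: pos_le_divide_eq mult.commute)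
    ultimately have "(\<lambda>k. (a (Suc k))\<^sup>2) \<longlonglongrightarrow> 0"
      by (intro Lim_null_comparison[of "\<lambda>k. (a (Suc k))\<^sup>2"] always_eventually) auto
    then have "(\<lambda>k. sqrt ((a (Suc k))\<^sup>2)) \<longlonglongrightarrow> sqrt 0"
      by (rule tendsto_real_sqrt)
    then have a_lim: "a \<longlonglongrightarrow> 0"
      using a by (simp add: filterlim_sequentially_Suc)
    \<comment> \<open>This expression will bound the distance travelled after index
      \<open>k\<close>. It has to drop below \<open>\<epsilon> / 2\<close>, the other half of the
      radius being left for the distance from \<open>z K\<close> to \<open>p\<close>.\<close>
    have "(\<lambda>k. C * (2 * a k + 4 * M * \<Phi> k)) \<longlonglongrightarrow> C * (2 * 0 + 4 * M * 0)"
      by (intro tendsto_intros a_lim \<Phi>_lim)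
    then have "\<forall>\<^sub>F k in sequentially. C * (2 * a k + 4 * M * \<Phi> k) < \<epsilon> / 2"
      using \<epsilon> by (intro order_tendstoD[where y = "0::real"]) auto
    then obtain N where N: "\<And>k. N \<le> k \<Longrightarrow> C * (2 * a k + 4 * M * \<Phi> k) < \<epsilon> / 2 \<and> q (z k) - q p < c"
      using eventually_conj[OF _ ev_c] unfolding eventually_sequentially by metis
    have "\<forall>\<^sub>F k in sequentially. dist ((z \<circ> \<theta>) k) p < \<epsilon> / 2"
      using \<epsilon> by (intro tendstoD[OF sub(2)]) simp
    then obtain j where j: "N \<le> j" "dist (z (\<theta> j)) p < \<epsilon> / 2"
      unfolding eventually_sequentially by (metis comp_apply nat_le_linear)
    define K where "K = \<theta> j"
    have K: "N \<le> K" "dist (z K) p < \<epsilon> / 2"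
      using j seq_suble[OF sub(1), of j] by (auto simp: K_def)
    have in_range: "q (z k) - q p \<in> {0<..<c}" if "K \<le> k" for k
      using N[of k] above[of k] that K by auto
    have \<Phi>_nonneg: "0 \<le> \<Phi> k" if "K \<le> k" for k
      using in_range[OF that] \<phi>_nonneg by (auto simp: \<Phi>_def)
    \<comment> \<open>The tangent inequality and descent bound
      \<open>D * \<delta> * (a (Suc k))\<^sup>2\<close> by the decrease of \<open>\<Phi>\<close>;
      the KL inequality and the gradient bound give
      \<open>1 \<le> D * (C * (a (Suc k) + a k))\<close>. Combining the two eliminates the unknown
      slope \<open>D\<close>.\<close>
    have contract: "3 * a (Suc k) \<le> a k + 4 * M * (\<Phi> k - \<Phi> (Suc k))"
      if k: "K \<le> k" and near: "dist p (z k) < \<epsilon>" for k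
    proof (rule linear_step_from_quadratic)
      define D where "D = \<phi>' (q (z k) - q p)"
      have D: "0 < D" unfolding D_def by (rule \<phi>'_pos[OF in_range[OF k]])
      have "\<Phi> (Suc k) \<le> \<Phi> k + D * (q (z (Suc k)) - q (z k))"
        using tangent[OF in_range[OF k], of "q (z (Suc k)) - q p"] in_range[of "Suc k"] k
        by (simp add: \<Phi>_def D_def)
      moreover have "D * (\<delta> * (a (Suc k))\<^sup>2) \<le> D * (q (z k) - q (z (Suc k)))"
        using descent[of k] D by (intro mult_left_mono) auto
      ultimately have gain: "D * (\<delta> * (a (Suc k))\<^sup>2) \<le> \<Phi> k - \<Phi> (Suc k)"
        by (simp add: algebra_simps)
      then show "0 \<le> M * (\<Phi> k - \<Phi> (Suc k))"
        using M D pos by (smt (verit) mult_nonneg_nonneg zero_le_power2)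
      have "1 \<le> D * norm (grad q (z k))"
        unfolding D_def using near above[of k] in_range[OF k] by (intro ineq) auto
      also have "\<dots> \<le> D * (C * (a (Suc k) + a k))"
        using grad D by (intro mult_left_mono) auto
      finally have one: "1 \<le> D * (C * (a (Suc k) + a k))" .
      have "\<delta> * (a (Suc k))\<^sup>2 * 1 \<le> \<delta> * (a (Suc k))\<^sup>2 * (D * (C * (a (Suc k) + a k)))"
        using one pos by (intro mult_left_mono) auto
      also have "\<dots> = D * (\<delta> * (a (Suc k))\<^sup>2) * (C * (a (Suc k) + a k))"
        by (simp add: mult_ac)
      also have "\<dots> \<le> (\<Phi> k - \<Phi> (Suc k)) * (C * (a (Suc k) + a k))"
        using gain pos a by (intro mult_right_mono) auto
      finally show "(a (Suc k))\<^sup>2 \<le> M * (\<Phi> k - \<Phi> (Suc k)) * (a (Suc k) + a k)"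
        using pos by (simp add: M_def field_simps)
    qed (use a in auto)
    \<comment> \<open>The summed contraction bounds the path length, which keeps the next iterate in the
      neighbourhood where the contraction is available.\<close>
    have trapped: "2 * (\<Sum>i<n. a (Suc (K + i))) + a (K + n) \<le> a K + 4 * M * (\<Phi> K - \<Phi> (K + n)) \<and>
      dist (z (K + n)) (z K) \<le> C * (2 * (\<Sum>i<n. a (Suc (K + i))) + a K - a (K + n))" for n
    proof (induction n)
      case (Suc n)
      define \<Sigma> where "\<Sigma> = (\<Sum>i<n. a (Suc (K + i)))"
      have IH: "2 * \<Sigma> + a (K + n) \<le> a K + 4 * M * (\<Phi> K - \<Phi> (K + n))"
        "dist (z (K + n)) (z K) \<le> C * (2 * \<Sigma> + a K - a (K + n))"
        using Suc.IH by (auto simp: \<Sigma>_def)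
      have "0 \<le> M * \<Phi> (K + n)"
        using M \<Phi>_nonneg by simp
      then have "2 * \<Sigma> + a K - a (K + n) \<le> 2 * a K + 4 * M * \<Phi> K"
        using IH(1) a[of "K + n"] by (simp add: algebra_simps)
      then have "C * (2 * \<Sigma> + a K - a (K + n)) < \<epsilon> / 2"
        using N[OF K(1)] pos by (meson mult_left_mono order_le_less_trans)
      then have "dist p (z (K + n)) < \<epsilon>"
        using IH(2) K(2) dist_triangle[of p "z (K + n)" "z K"] by (simp add: dist_commute)
      then have "3 * a (Suc (K + n)) \<le> a (K + n) + 4 * M * (\<Phi> (K + n) - \<Phi> (Suc (K + n)))"
        by (intro contract) auto
      moreover have "dist (z (Suc (K + n))) (z K) \<le> C * (a (Suc (K + n)) + a (K + n)) + dist (z (K + n)) (z K)"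
        using dist_triangle[of "z (Suc (K + n))" "z K" "z (K + n)"] step[of "K + n"]
        by (simp add: dist_norm)
      moreover have "(\<Sum>i<Suc n. a (Suc (K + i))) = \<Sigma> + a (Suc (K + n))"
        by (simp add: \<Sigma>_def)
      ultimately show ?case
        using IH by (simp add: algebra_simps)
    qed simp
    have "summable (\<lambda>i. a (Suc (K + i)))"
    proof (rule summableI_nonneg_bounded)
      fix n
      have "0 \<le> M * \<Phi> (K + n)" "0 \<le> a (K + n)" "0 \<le> (\<Sum>i<n. a (Suc (K + i)))"
        using M \<Phi>_nonneg a by (auto intro: sum_nonneg)
      then show "(\<Sum>i<n. a (Suc (K + i))) \<le> a K + 4 * M * \<Phi> K"
        using trapped[of n] by (simp add: algebra_simps)
    qed (rule a)
    then have "summable (\<lambda>i. a (i + Suc K))"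
      by (simp add: add_ac)
    then show ?thesis
      by (rule summable_iff_shift[THEN iffD1])
  qed
qed

section \<open>Subproblems and the augmented Lagrangian\<close>

text \<open>The objective expands exactly along its own gradient \<open>G\<close> at the minimiser,
  with linear coefficient \<open>G \<bullet> G\<close>. Replacing \<open>A *v xm\<close> by
  \<open>A *v xk\<close> in the penalty moves a Gram term into the matrix, and what precedes the
  matrix is the partial gradient of the augmented Lagrangian at the old point.\<close>

lemma x_subproblem_optimality:
  assumes H: "symmetric_mat H"
    and opt: "is_arg_min (x_subproblem f A \<beta> l H xk yk lam) (\<lambda>_. True) xm"
  shows "grad f xk - transpose A *v lam + \<beta> *\<^sub>R (transpose A *v (A *v xk - yk))
    + (H + \<beta> *\<^sub>R (transpose A ** A) + l *\<^sub>R mat 1) *v (xm - xk) = 0"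
proof -
  define \<Phi> where "\<Phi> = x_subproblem f A \<beta> l H xk yk lam"
  define G where "G = grad f xk - transpose A *v lam + \<beta> *\<^sub>R (transpose A *v (A *v xm - yk))
    + H *v (xm - xk) + l *\<^sub>R (xm - xk)"
  have "\<Phi> (xm + t *\<^sub>R G) - \<Phi> xm = t * (G \<bullet> G)
      + t\<^sup>2 * (wnorm2 H G / 2 + \<beta> / 2 * (norm (A *v G))\<^sup>2 + l / 2 * (norm G)\<^sup>2)" for t
  proof -
    have shift: "xm + t *\<^sub>R G - xk = (xm - xk) + t *\<^sub>R G"
      "A *v (xm + t *\<^sub>R G) - yk = (A *v xm - yk) + t *\<^sub>R (A *v G)"
      by (simp_all add: matrix_vector_right_distrib matrix_vector_mult_scaleR)
    have GG: "G \<bullet> G = G \<bullet> grad f xk - (A *v G) \<bullet> lam + \<beta> * ((A *v G) \<bullet> (A *v xm - yk))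
        + G \<bullet> (H *v (xm - xk)) + l * (G \<bullet> (xm - xk))"
      by (subst (2) G_def)
        (simp only: inner_add_right inner_diff_right inner_scaleR_right inner_transpose_matrix_vector)
    show ?thesis
      unfolding GG \<Phi>_def x_subproblem_def shift wnorm2_add_scaled[OF H] norm_add_scaled_sq
      by (simp add: inner_add_right inner_commute algebra_simps)
  qed
  moreover have "\<Phi> xm \<le> \<Phi> (xm + t *\<^sub>R G)" for t
    using opt unfolding \<Phi>_def by (auto simp: is_arg_min_linorder)
  ultimately have "0 \<le> t * (G \<bullet> G)
      + t\<^sup>2 * (wnorm2 H G / 2 + \<beta> / 2 * (norm (A *v G))\<^sup>2 + l / 2 * (norm G)\<^sup>2)" for t
    by (metis diff_ge_0_iff_ge)
  then have "G \<bullet> G = 0"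
    by (rule linear_coeff_zero_if_quadratic_nonneg)
  then have "G = 0"
    by simp
  then show ?thesis
    unfolding G_def
    by (simp add: matrix_vector_mult_add_rdistrib scaleR_matrix_vector_assoc[symmetric]
        matrix_vector_mul_assoc[symmetric] matrix_vector_mult_diff_distrib algebra_simps
        del: transpose_matrix_vector)
qed

lemma y_subproblem_optimality:
  assumes H: "symmetric_mat H"
    and opt: "is_arg_min (y_subproblem g A \<beta> \<sigma> H xn yk lam) (\<lambda>_. True) ym"
  shows "grad g yk + lam - \<beta> *\<^sub>R (A *v xn - yk) + (H + (\<beta> + \<sigma>) *\<^sub>R mat 1) *v (ym - yk) = 0"
proof -
  define \<Phi> where "\<Phi> = y_subproblem g A \<beta> \<sigma> H xn yk lam"
  define G where "G = grad g yk + lam - \<beta> *\<^sub>R (A *v xn - ym) + H *v (ym - yk) + \<sigma> *\<^sub>R (ym - yk)"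
  have "\<Phi> (ym + t *\<^sub>R G) - \<Phi> ym = t * (G \<bullet> G)
      + t\<^sup>2 * (wnorm2 H G / 2 + \<beta> / 2 * (norm G)\<^sup>2 + \<sigma> / 2 * (norm G)\<^sup>2)" for t
  proof -
    have shift: "ym + t *\<^sub>R G - yk = (ym - yk) + t *\<^sub>R G"
      "A *v xn - (ym + t *\<^sub>R G) = (A *v xn - ym) + t *\<^sub>R (- G)"
      by simp_all
    have GG: "G \<bullet> G = G \<bullet> grad g yk + G \<bullet> lam - \<beta> * (G \<bullet> (A *v xn - ym))
        + G \<bullet> (H *v (ym - yk)) + \<sigma> * (G \<bullet> (ym - yk))"
      by (subst (2) G_def) (simp only: inner_add_right inner_diff_right inner_scaleR_right)
    show ?thesis
      unfolding GG \<Phi>_def y_subproblem_def shift wnorm2_add_scaled[OF H] norm_add_scaled_sq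
      by (simp add: inner_add_right inner_commute algebra_simps)
  qed
  moreover have "\<Phi> ym \<le> \<Phi> (ym + t *\<^sub>R G)" for t
    using opt unfolding \<Phi>_def by (auto simp: is_arg_min_linorder)
  ultimately have "0 \<le> t * (G \<bullet> G)
      + t\<^sup>2 * (wnorm2 H G / 2 + \<beta> / 2 * (norm G)\<^sup>2 + \<sigma> / 2 * (norm G)\<^sup>2)" for t
    by (metis diff_ge_0_iff_ge)
  then have "G \<bullet> G = 0"
    by (rule linear_coeff_zero_if_quadratic_nonneg)
  then have "G = 0"
    by simp
  then show ?thesis
    unfolding G_def
    by (simp add: matrix_vector_mult_add_rdistrib scaleR_matrix_vector_assoc[symmetric] algebra_simps)
qed

text \<open>The penalty expands exactly along the direction. Its factor 1/2 is given up, so that the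
  quadratic coefficient is the denominator occurring in \<gamma>.\<close>

lemma aug_lag_x_upper_bound:
  assumes "C1_fun f" "L-lipschitz_on S (grad f)"
    and "\<And>t. t \<in> {0..1} \<Longrightarrow> x + t *\<^sub>R d \<in> S" "t \<in> {0..1}" "0 \<le> \<beta>"
  shows "aug_lag f g A \<beta> (x + t *\<^sub>R d, y, lam) \<le> aug_lag f g A \<beta> (x, y, lam)
    + t * (d \<bullet> (grad f x - transpose A *v lam + \<beta> *\<^sub>R (transpose A *v (A *v x - y))))
    + t\<^sup>2 * ((L + \<beta> * spectral_norm (transpose A ** A)) * (norm d)\<^sup>2)"
proof -
  have shift: "A *v (x + t *\<^sub>R d) - y = (A *v x - y) + t *\<^sub>R (A *v d)"
    by (simp add: matrix_vector_right_distrib matrix_vector_mult_scaleR)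
  have "0 \<le> (norm (A *v d))\<^sup>2" by simp
  then have "\<beta> / 2 * (t\<^sup>2 * (norm (A *v d))\<^sup>2)
      \<le> \<beta> * (t\<^sup>2 * (spectral_norm (transpose A ** A) * (norm d)\<^sup>2))"
    using norm_matrix_vector_sq_le[of A d] \<open>0 \<le> \<beta>\<close> by (intro mult_mono mult_left_mono) auto
  then show ?thesis
    using lipschitz_grad_upper_bound[OF assms(1-4)]
    unfolding aug_lag.simps shift norm_add_scaled_sq inner_add_right inner_diff_right
      inner_scaleR_right inner_transpose_matrix_vector
    by (simp add: inner_commute algebra_simps)
qed

lemma aug_lag_y_upper_bound:
  assumes "C1_fun g" "L-lipschitz_on S (grad g)"
    and "\<And>t. t \<in> {0..1} \<Longrightarrow> y + t *\<^sub>R d \<in> S" "t \<in> {0..1}" "0 \<le> \<beta>"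
  shows "aug_lag f g A \<beta> (x, y + t *\<^sub>R d, lam) \<le> aug_lag f g A \<beta> (x, y, lam)
    + t * (d \<bullet> (grad g y + lam - \<beta> *\<^sub>R (A *v x - y))) + t\<^sup>2 * ((L + \<beta>) * (norm d)\<^sup>2)"
proof -
  have shift: "A *v x - (y + t *\<^sub>R d) = (A *v x - y) + t *\<^sub>R (- d)"
    by simp
  have "\<beta> / 2 * (t\<^sup>2 * (norm d)\<^sup>2) \<le> \<beta> * (t\<^sup>2 * (norm d)\<^sup>2)"
    using \<open>0 \<le> \<beta>\<close> by (intro mult_right_mono) auto
  then show ?thesis
    using lipschitz_grad_upper_bound[OF assms(1-4)]
    unfolding aug_lag.simps shift norm_add_scaled_sq
    by (simp add: inner_simps inner_commute algebra_simps)
qed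

text \<open>The augmented Lagrangian is affine in the multiplier with slope
  \<open>- (A *v x - y)\<close>. For positive \<open>c\<close> this change is an increase, which the
  descent in both blocks has to outweigh.\<close>

lemma aug_lag_multiplier_change:
  "aug_lag f g A \<beta> (x, y, lam - c *\<^sub>R (A *v x - y))
    = aug_lag f g A \<beta> (x, y, lam) + c * (norm (A *v x - y))\<^sup>2"
  by (simp add: inner_diff_left power2_norm_eq_inner)

lemma GDERIV_aug_lag:
  fixes f :: "real^'n1 \<Rightarrow> real" and g :: "real^'n2 \<Rightarrow> real" and A :: "real^'n1^'n2"
  assumes "C1_fun f" "C1_fun g"
  shows "GDERIV (aug_lag f g A \<beta>) (x, y, lam) :>
    (grad f x - transpose A *v lam + \<beta> *\<^sub>R (transpose A *v (A *v x - y)),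
     grad g y + lam - \<beta> *\<^sub>R (A *v x - y), - (A *v x - y))"
proof -
  have f: "(f has_derivative (\<lambda>h. h \<bullet> grad f x)) (at (fst (x, y, lam)))"
    and g: "(g has_derivative (\<lambda>h. h \<bullet> grad g y)) (at (fst (snd (x, y, lam))))"
    using assms by (simp_all add: C1_fun_def gderiv_def)
  have eq: "aug_lag f g A \<beta> = (\<lambda>w. f (fst w) + g (fst (snd w))
      - snd (snd w) \<bullet> (A *v fst w - fst (snd w))
      + \<beta> / 2 * ((A *v fst w - fst (snd w)) \<bullet> (A *v fst w - fst (snd w))))"
    by (auto simp: fun_eq_iff power2_norm_eq_inner)
  have fd: "((\<lambda>w. f (fst w)) has_derivative (\<lambda>h. fst h \<bullet> grad f x)) (at (x, y, lam))"
    by (rule has_derivative_compose[OF has_derivative_fst[OF has_derivative_ident] f])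
  have gd: "((\<lambda>w. g (fst (snd w))) has_derivative (\<lambda>h. fst (snd h) \<bullet> grad g y)) (at (x, y, lam))"
    by (rule has_derivative_compose[OF has_derivative_fst[OF has_derivative_snd[OF has_derivative_ident]] g])
  have Ad: "((\<lambda>w. A *v fst w - fst (snd w)) has_derivative (\<lambda>h. A *v fst h - fst (snd h)))
      (at (x, y, lam))"
    by (intro has_derivative_diff has_derivative_fst has_derivative_snd has_derivative_ident
        bounded_linear.has_derivative[OF matrix_vector_mul_bounded_linear])
  have ld: "((\<lambda>w. snd (snd w)) has_derivative (\<lambda>h. snd (snd h))) (at (x, y, lam))"
    by (intro has_derivative_snd has_derivative_ident)
  let ?v = "A *v x - y"
  have "(aug_lag f g A \<beta> has_derivative (\<lambda>h. fst h \<bullet> grad f x + fst (snd h) \<bullet> grad g y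
      - (lam \<bullet> (A *v fst h - fst (snd h)) + snd (snd h) \<bullet> ?v)
      + \<beta> / 2 * (?v \<bullet> (A *v fst h - fst (snd h)) + (A *v fst h - fst (snd h)) \<bullet> ?v)))
      (at (x, y, lam))"
    unfolding eq
    using has_derivative_add[OF has_derivative_diff[OF has_derivative_add[OF fd gd]
        has_derivative_inner[OF ld Ad]] has_derivative_mult_right[OF has_derivative_inner[OF Ad Ad], of "\<beta> / 2"]]
    by simp
  then show ?thesis
    unfolding gderiv_def
    by (rule has_derivative_eq_rhs)
      (simp add: fun_eq_iff inner_simps inner_transpose_matrix_vector inner_commute algebra_simps
        del: transpose_matrix_vector)
qed

lemma grad_merit:
  fixes f :: "real^'n1 \<Rightarrow> real" and g :: "real^'n2 \<Rightarrow> real" and A :: "real^'n1^'n2"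
  assumes "C1_fun f" "C1_fun g"
  shows "grad (merit f g A \<beta> r s \<alpha> Lg \<eta>2y) ((x, y, lam), d) =
    ((grad f x - transpose A *v lam + \<beta> *\<^sub>R (transpose A *v (A *v x - y)),
      grad g y + lam - \<beta> *\<^sub>R (A *v x - y), - (A *v x - y)),
     (2 * (6 / (\<bar>r + s\<bar> * \<beta>) * (Lg\<^sup>2 + \<beta>\<^sup>2 + (\<eta>2y / (1 + \<alpha>))\<^sup>2))) *\<^sub>R d)"
    (is "_ = (?D, (2 * ?c) *\<^sub>R d)")
proof (rule grad_eqI)
  have eq: "merit f g A \<beta> r s \<alpha> Lg \<eta>2y = (\<lambda>z. aug_lag f g A \<beta> (fst z) + ?c * (snd z \<bullet> snd z))"
    by (auto simp: fun_eq_iff power2_norm_eq_inner)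
  have L: "(aug_lag f g A \<beta> has_derivative (\<lambda>h. h \<bullet> ?D)) (at (fst ((x, y, lam), d)))"
    using GDERIV_aug_lag[OF assms] by (simp add: gderiv_def)
  have Ld: "((\<lambda>z. aug_lag f g A \<beta> (fst z)) has_derivative (\<lambda>h. fst h \<bullet> ?D)) (at ((x, y, lam), d))"
    by (rule has_derivative_compose[OF has_derivative_fst[OF has_derivative_ident] L])
  have dd: "(snd has_derivative snd) (at ((x, y, lam), d))"
    by (intro has_derivative_snd has_derivative_ident)
  have "(merit f g A \<beta> r s \<alpha> Lg \<eta>2y has_derivative
      (\<lambda>h. fst h \<bullet> ?D + ?c * (d \<bullet> snd h + snd h \<bullet> d))) (at ((x, y, lam), d))"
    unfolding eq
    using has_derivative_add[OF Ld has_derivative_mult_right[OF has_derivative_inner[OF dd dd], of ?c]]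
    by simp
  then show "GDERIV (merit f g A \<beta> r s \<alpha> Lg \<eta>2y) ((x, y, lam), d) :> (?D, (2 * ?c) *\<^sub>R d)"
    unfolding gderiv_def
    by (rule has_derivative_eq_rhs) (simp add: fun_eq_iff inner_prod_def inner_commute algebra_simps)
qed

text \<open>Source of the factor 6 in the constants: the multiplier difference has six summands,
  split here as two groups of three.\<close>

lemma norm_add6_sq:
  fixes t1 t2 t3 t4 t5 t6 :: "'a::real_normed_vector"
  shows "(norm (t1 + t2 + t3 + t4 + t5 + t6))\<^sup>2 \<le> 6 * ((norm t1)\<^sup>2 + (norm t2)\<^sup>2 + (norm t3)\<^sup>2
    + (norm t4)\<^sup>2 + (norm t5)\<^sup>2 + (norm t6)\<^sup>2)"
proof -
  have two: "(norm (u + v))\<^sup>2 \<le> 2 * ((norm u)\<^sup>2 + (norm v)\<^sup>2)" for u v :: 'a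
  proof -
    have "(norm (u + v))\<^sup>2 \<le> (norm u + norm v)\<^sup>2"
      by (intro power_mono norm_triangle_ineq norm_ge_zero)
    also have "\<dots> \<le> 2 * ((norm u)\<^sup>2 + (norm v)\<^sup>2)"
      using zero_le_power2[of "norm u - norm v"] by (simp add: power2_eq_square algebra_simps)
    finally show ?thesis .
  qed
  have three: "(norm (u + v + w))\<^sup>2 \<le> 3 * ((norm u)\<^sup>2 + (norm v)\<^sup>2 + (norm w)\<^sup>2)" for u v w :: 'a
  proof -
    have "(norm (u + v + w))\<^sup>2 \<le> (norm u + norm v + norm w)\<^sup>2"
      by (intro power_mono norm_triangle_le add_right_mono norm_triangle_ineq norm_ge_zero)
    also have "\<dots> \<le> 3 * ((norm u)\<^sup>2 + (norm v)\<^sup>2 + (norm w)\<^sup>2)"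
      using zero_le_power2[of "norm u - norm v"] zero_le_power2[of "norm u - norm w"]
        zero_le_power2[of "norm v - norm w"] by (simp add: power2_eq_square algebra_simps)
    finally show ?thesis .
  qed
  show ?thesis
    using two[of "t1 + t2 + t3" "t4 + t5 + t6"] three[of t1 t2 t3] three[of t4 t5 t6]
    by (simp add: add.assoc)
qed

text \<open>Multiplying the left side by \<open>r + s\<close> gives an identity. Since
  \<open>r + s\<close> may be negative, absolute values are taken of the whole quotient before it is
  split.\<close>

lemma weighted_norm_sq_sum_le:
  fixes u v :: "'a::real_inner"
  assumes "r + s \<noteq> 0"
  shows "r * (norm u)\<^sup>2 + s * (norm v)\<^sup>2
    \<le> ((norm (r *\<^sub>R u + s *\<^sub>R v))\<^sup>2 + \<bar>r * s\<bar> * (norm (u - v))\<^sup>2) / \<bar>r + s\<bar>"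
proof -
  let ?X = "(norm (r *\<^sub>R u + s *\<^sub>R v))\<^sup>2 + r * s * (norm (u - v))\<^sup>2"
  have "(r + s) * (r * (norm u)\<^sup>2 + s * (norm v)\<^sup>2) = ?X"
    unfolding power2_norm_eq_inner by (simp add: inner_simps inner_commute algebra_simps)
  then have "r * (norm u)\<^sup>2 + s * (norm v)\<^sup>2 = ?X / (r + s)"
    using assms by (simp add: field_simps)
  also have "\<dots> \<le> \<bar>?X\<bar> / \<bar>r + s\<bar>"
    by (metis abs_divide abs_ge_self)
  also have "\<dots> \<le> ((norm (r *\<^sub>R u + s *\<^sub>R v))\<^sup>2 + \<bar>r * s\<bar> * (norm (u - v))\<^sup>2) / \<bar>r + s\<bar>"
    using abs_triangle_ineq[of "(norm (r *\<^sub>R u + s *\<^sub>R v))\<^sup>2" "r * s * (norm (u - v))\<^sup>2"]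
    by (intro divide_right_mono) (auto simp: abs_mult)
  finally show ?thesis .
qed

section \<open>Convergence of the algorithm\<close>

theorem theorem2:
  fixes f :: "real^'n1 \<Rightarrow> real" and g :: "real^'n2 \<Rightarrow> real" and A :: "real^'n1^'n2"
    and \<rho> \<nu> \<alpha> \<beta> l \<sigma> r s :: real
    and Hx HHx :: "nat \<Rightarrow> real^'n1^'n1" and Hy HHy :: "nat \<Rightarrow> real^'n2^'n2"
    and x xt xb dx :: "nat \<Rightarrow> real^'n1"
    and y yt yb dy lam lamh :: "nat \<Rightarrow> real^'n2"
    and tx ty :: "nat \<Rightarrow> real"
    and w :: "nat \<Rightarrow> (real^'n1) \<times> (real^'n2) \<times> (real^'n2)"
    and \<eta>x \<eta>y lowx lowy \<eta>1x \<eta>1y \<eta>2y Lf Lg \<gamma> \<delta>x \<delta>y :: real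
    and Sx :: "(real^'n1) set" and Sy :: "(real^'n2) set"
  assumes f_C1: "C1_fun f" and g_C1: "C1_fun g"
    (* parameters *)
    and rho: "0 < \<rho>" "\<rho> < 1" and nu: "0 < \<nu>" "\<nu> < 1"
    and alpha: "-1 < \<alpha>" "\<alpha> < 1/\<rho> - 1"
    and beta: "0 < \<beta>" and ell: "0 < l" and sigma: "0 < \<sigma>" and rs: "r + s \<noteq> 0"
    and Hx_sym: "\<And>k. symmetric_mat (Hx k)" and Hy_sym: "\<And>k. symmetric_mat (Hy k)"
    and H0_pd: "pos_def (Hx 0)" "pos_def (Hy 0)"
    and HHx_def: "\<And>k. HHx k = Hx k + \<beta> *\<^sub>R (transpose A ** A) + l *\<^sub>R mat 1"
    and HHy_def: "\<And>k. HHy k = Hy k + (\<beta> + \<sigma>) *\<^sub>R mat 1"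
    and HHx_pd: "\<And>k. pos_def (HHx k)" and HHy_pd: "\<And>k. pos_def (HHy k)"
    (* x-update *)
    and xt_argmin: "\<And>k. is_arg_min (x_subproblem f A \<beta> l (Hx k) (x k) (y k) (lam k))
                            (\<lambda>_. True) (xt (Suc k))"
    and xb_eq: "\<And>k. xb (Suc k) = xt (Suc k) + \<alpha> *\<^sub>R (xt (Suc k) - x k)"
    and dx_eq: "\<And>k. dx k = xb (Suc k) - x k"
    and tx_eq: "\<And>k. tx k = \<nu> ^ (LEAST i. aug_lag f g A \<beta> (x k + \<nu>^i *\<^sub>R dx k, y k, lam k)
                            \<le> aug_lag f g A \<beta> (x k, y k, lam k) - \<rho> * \<nu>^i * wnorm2 (HHx k) (dx k))"
    and x_Suc: "\<And>k. x (Suc k) = x k + tx k *\<^sub>R dx k"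
    (* first multiplier update; lamh k is the multiplier with index k + 1/2 *)
    and lamh_eq: "\<And>k. lamh k = lam k - (r * \<beta>) *\<^sub>R (A *v x (Suc k) - y k)"
    (* y-update *)
    and yt_argmin: "\<And>k. is_arg_min (y_subproblem g A \<beta> \<sigma> (Hy k) (x (Suc k)) (y k) (lamh k))
                            (\<lambda>_. True) (yt (Suc k))"
    and yb_eq: "\<And>k. yb (Suc k) = yt (Suc k) + \<alpha> *\<^sub>R (yt (Suc k) - y k)"
    and dy_eq: "\<And>k. dy k = yb (Suc k) - y k"
    and ty_eq: "\<And>k. ty k = \<nu> ^ (LEAST i. aug_lag f g A \<beta> (x (Suc k), y k + \<nu>^i *\<^sub>R dy k, lamh k)
                            \<le> aug_lag f g A \<beta> (x (Suc k), y k, lamh k) - \<rho> * \<nu>^i * wnorm2 (HHy k) (dy k))"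
    and y_Suc: "\<And>k. y (Suc k) = y k + ty k *\<^sub>R dy k"
    (* second multiplier update *)
    and lam_Suc: "\<And>k. lam (Suc k) = lamh k - (s * \<beta>) *\<^sub>R (A *v x (Suc k) - y (Suc k))"
    and w_eq: "\<And>k. w k = (x k, y k, lam k)"
    (* boundedness, curvature bounds, local Lipschitz gradients *)
    and w_bounded: "bounded (range w)"
    and Hx_bound: "\<And>k. spectral_norm (Hx k) \<le> \<eta>x" and Hy_bound: "\<And>k. spectral_norm (Hy k) \<le> \<eta>y"
    and Hx_lower: "\<And>k. lowx \<le> lambda_min (Hx k)" and Hy_lower: "\<And>k. lowy \<le> lambda_min (Hy k)"
    and \<eta>1x_def: "\<eta>1x = lowx + \<beta> * lambda_min (transpose A ** A) + l" and \<eta>1x_pos: "0 < \<eta>1x"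
    and \<eta>1y_def: "\<eta>1y = lowy + \<beta> + \<sigma>" and \<eta>1y_pos: "0 < \<eta>1y"
    and f_loclip: "locally_lipschitz (grad f)" and g_loclip: "locally_lipschitz (grad g)"
    (* constants *)
    and \<eta>2y_def: "\<eta>2y = \<eta>y + \<beta> + \<sigma>"
    and Sx_compact: "compact Sx" and Sy_compact: "compact Sy"
    and Sx_seg: "\<And>k t. t \<in> {0..1} \<Longrightarrow> x k + t *\<^sub>R dx k \<in> Sx"
    and Sy_seg: "\<And>k t. t \<in> {0..1} \<Longrightarrow> y k + t *\<^sub>R dy k \<in> Sy"
    and Lf: "0 < Lf" "Lf-lipschitz_on Sx (grad f)"
    and Lg: "0 < Lg" "Lg-lipschitz_on Sy (grad g)"
    and \<gamma>_def: "\<gamma> = \<nu> * Min {1,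
                   (1 / (1 + \<alpha>) - \<rho>) * \<eta>1x / (Lf + \<beta> * spectral_norm (transpose A ** A)),
                   (1 / (1 + \<alpha>) - \<rho>) * \<eta>1y / (Lg + \<beta>)}"
    and \<delta>y_def: "\<delta>y = \<rho> * \<gamma> * \<eta>1y
                   - 6 / (\<bar>r + s\<bar> * \<beta>) * (Lg\<^sup>2 + (1 + s\<^sup>2) * \<beta>\<^sup>2 + 2 * (\<eta>2y / (1 + \<alpha>))\<^sup>2)
                   - \<bar>r * s\<bar> * \<beta> / \<bar>r + s\<bar>"
    and \<delta>x_def: "\<delta>x = \<rho> * \<gamma> * \<eta>1x
                   - 6 * (1 - s)\<^sup>2 * \<beta> * lambda_max (transpose A ** A) / \<bar>r + s\<bar>"
    (* parameter choice *)
    and \<delta>x_pos: "0 < \<delta>x" and \<delta>y_pos: "0 < \<delta>y"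
    and KL: "KL_function (merit f g A \<beta> r s \<alpha> Lg \<eta>2y)"
  shows "summable (\<lambda>k. norm (w (Suc k) - w k)) \<and>
         (\<exists>xs ys lams. w \<longlonglongrightarrow> (xs, ys, lams) \<and>
            (GDERIV (aug_lag f g A \<beta>) (xs, ys, lams) :> 0) \<and>
            KKT_point f g A xs ys lams)"
proof -

  \<comment> \<open>Optimality conditions in terms of the search directions\<close>
  define B where "B = transpose A ** A"
  define \<kappa> where "\<kappa> = 1 / (1 + \<alpha>)"
  define E where "E = \<eta>2y / (1 + \<alpha>)"
  have \<kappa>: "0 < \<kappa>" "\<rho> < \<kappa>"
    using alpha rho by (auto simp: \<kappa>_def field_simps)
  have E_eq: "E = \<kappa> * \<eta>2y"
    by (simp add: E_def \<kappa>_def)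

  \<comment> \<open>Undoing the extrapolation divides the direction by \<open>1 + \<alpha>\<close>;
    this is where the factor \<kappa> enters all later constants.\<close>
  have xt: "xt (Suc k) - x k = \<kappa> *\<^sub>R dx k" for k
  proof -
    have "dx k = (1 + \<alpha>) *\<^sub>R (xt (Suc k) - x k)"
      by (simp add: dx_eq xb_eq algebra_simps)
    then show ?thesis
      using alpha by (simp add: \<kappa>_def)
  qed
  have yt: "yt (Suc k) - y k = \<kappa> *\<^sub>R dy k" for k
  proof -
    have "dy k = (1 + \<alpha>) *\<^sub>R (yt (Suc k) - y k)"
      by (simp add: dy_eq yb_eq algebra_simps)
    then show ?thesis
      using alpha by (simp add: \<kappa>_def)
  qed
  \<comment> \<open>Pairing this with \<open>dx k\<close> gives the slope
    \<open>- (\<kappa> * wnorm2 (HHx k) (dx k))\<close> along the search direction, the linear term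
    that the line search lemma expects.\<close>
  have gradx: "grad f (x k) - transpose A *v lam k + \<beta> *\<^sub>R (transpose A *v (A *v x k - y k))
      = - (\<kappa> *\<^sub>R (HHx k *v dx k))" for k
    using x_subproblem_optimality[OF Hx_sym xt_argmin, of k]
    unfolding HHx_def[symmetric] xt by (simp only: matrix_vector_mult_scaleR eq_neg_iff_add_eq_0)
  have grady: "grad g (y k) + lamh k - \<beta> *\<^sub>R (A *v x (Suc k) - y k)
      = - (\<kappa> *\<^sub>R (HHy k *v dy k))" for k
    using y_subproblem_optimality[OF Hy_sym yt_argmin, of k]
    unfolding HHy_def[symmetric] yt by (simp only: matrix_vector_mult_scaleR eq_neg_iff_add_eq_0)

  \<comment> \<open>Curvature of the regularised matrices from below\<close>
  have HHx_lower: "\<eta>1x * (norm v)\<^sup>2 \<le> wnorm2 (HHx k) v" for k v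
  proof -
    have "wnorm2 (HHx k) v = wnorm2 (Hx k) v + \<beta> * wnorm2 B v + l * (norm v)\<^sup>2"
      by (simp add: wnorm2_def HHx_def B_def matrix_vector_mult_add_rdistrib
          scaleR_matrix_vector_assoc[symmetric] inner_add_right power2_norm_eq_inner)
    moreover have "lowx * (norm v)\<^sup>2 \<le> wnorm2 (Hx k) v"
      using lambda_min_le_rayleigh[OF Hx_sym, of k v] Hx_lower[of k]
      by (meson mult_right_mono order_trans zero_le_power2)
    moreover have "\<beta> * (lambda_min B * (norm v)\<^sup>2) \<le> \<beta> * wnorm2 B v"
      using lambda_min_le_rayleigh[OF symmetric_mat_gram, of A v] beta by (simp add: B_def)
    ultimately show ?thesis
      by (simp add: \<eta>1x_def B_def algebra_simps)
  qed
  have HHy_lower: "\<eta>1y * (norm v)\<^sup>2 \<le> wnorm2 (HHy k) v" for k v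
  proof -
    have "wnorm2 (HHy k) v = wnorm2 (Hy k) v + (\<beta> + \<sigma>) * (norm v)\<^sup>2"
      by (simp add: wnorm2_def HHy_def matrix_vector_mult_add_rdistrib
          scaleR_matrix_vector_assoc[symmetric] inner_add_right power2_norm_eq_inner)
    moreover have "lowy * (norm v)\<^sup>2 \<le> wnorm2 (Hy k) v"
      using lambda_min_le_rayleigh[OF Hy_sym, of k v] Hy_lower[of k]
      by (meson mult_right_mono order_trans zero_le_power2)
    ultimately show ?thesis
      by (simp add: \<eta>1y_def algebra_simps)
  qed

  \<comment> \<open>Step sizes and decrease from the line searches\<close>
  have B_nonneg: "0 \<le> spectral_norm B"
    by (rule spectral_norm_nonneg)
  have \<gamma>_le: "\<gamma> \<le> \<nu> * min 1 ((\<kappa> - \<rho>) * \<eta>1x / (Lf + \<beta> * spectral_norm B))"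
    "\<gamma> \<le> \<nu> * min 1 ((\<kappa> - \<rho>) * \<eta>1y / (Lg + \<beta>))"
    unfolding \<gamma>_def \<kappa>_def B_def using nu by (auto intro!: mult_left_mono)
  have tx: "0 < tx k" "tx k \<le> 1" "\<gamma> \<le> tx k"
    and x_armijo: "aug_lag f g A \<beta> (x (Suc k), y k, lam k)
      \<le> aug_lag f g A \<beta> (x k, y k, lam k) - \<rho> * tx k * wnorm2 (HHx k) (dx k)" for k
  proof -
    have upper: "aug_lag f g A \<beta> (x k + t *\<^sub>R dx k, y k, lam k)
        \<le> aug_lag f g A \<beta> (x k, y k, lam k) - t * (\<kappa> * wnorm2 (HHx k) (dx k))
          + t\<^sup>2 * ((Lf + \<beta> * spectral_norm B) * (norm (dx k))\<^sup>2)" if "t \<in> {0..1}" for t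
      using aug_lag_x_upper_bound[OF f_C1 Lf(2) Sx_seg[where k = k] that less_imp_le[OF beta], where g = g and A = A
          and y = "y k" and lam = "lam k"]
      unfolding gradx B_def wnorm2_def by (simp del: aug_lag.simps)
    have M: "0 < Lf + \<beta> * spectral_norm B"
      using Lf(1) beta B_nonneg by (simp add: add_pos_nonneg)
    note armijo = armijo_backtracking[of "\<lambda>u. aug_lag f g A \<beta> (u, y k, lam k)", OF upper M
        zero_le_power2 \<eta>1x_pos HHx_lower \<kappa>(2) nu tx_eq]
    show "0 < tx k" "tx k \<le> 1"
      by (rule armijo; assumption)+
    show "aug_lag f g A \<beta> (x (Suc k), y k, lam k)
      \<le> aug_lag f g A \<beta> (x k, y k, lam k) - \<rho> * tx k * wnorm2 (HHx k) (dx k)"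
      unfolding x_Suc by (rule armijo(3))
    show "\<gamma> \<le> tx k"
      using \<gamma>_le(1) armijo(4) by linarith
  qed
  have ty: "0 < ty k" "ty k \<le> 1" "\<gamma> \<le> ty k"
    and y_armijo: "aug_lag f g A \<beta> (x (Suc k), y (Suc k), lamh k)
      \<le> aug_lag f g A \<beta> (x (Suc k), y k, lamh k) - \<rho> * ty k * wnorm2 (HHy k) (dy k)" for k
  proof -
    have upper: "aug_lag f g A \<beta> (x (Suc k), y k + t *\<^sub>R dy k, lamh k)
        \<le> aug_lag f g A \<beta> (x (Suc k), y k, lamh k) - t * (\<kappa> * wnorm2 (HHy k) (dy k))
          + t\<^sup>2 * ((Lg + \<beta>) * (norm (dy k))\<^sup>2)" if "t \<in> {0..1}" for t
      using aug_lag_y_upper_bound[OF g_C1 Lg(2) Sy_seg[where k = k] that less_imp_le[OF beta], where f = f and A = A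
          and x = "x (Suc k)" and lam = "lamh k"]
      unfolding grady wnorm2_def by (simp del: aug_lag.simps)
    have M: "0 < Lg + \<beta>"
      using Lg(1) beta by simp
    note armijo = armijo_backtracking[of "\<lambda>u. aug_lag f g A \<beta> (x (Suc k), u, lamh k)", OF upper M
        zero_le_power2 \<eta>1y_pos HHy_lower \<kappa>(2) nu ty_eq]
    show "0 < ty k" "ty k \<le> 1"
      by (rule armijo; assumption)+
    show "aug_lag f g A \<beta> (x (Suc k), y (Suc k), lamh k)
      \<le> aug_lag f g A \<beta> (x (Suc k), y k, lamh k) - \<rho> * ty k * wnorm2 (HHy k) (dy k)"
      unfolding y_Suc by (rule armijo(3))
    show "\<gamma> \<le> ty k"
      using \<gamma>_le(2) armijo(4) by linarith
  qed
  have x_descent: "\<rho> * \<gamma> * \<eta>1x * (norm (dx k))\<^sup>2 \<le> \<rho> * tx k * wnorm2 (HHx k) (dx k)" for k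
  proof -
    have "(\<rho> * \<gamma>) * (\<eta>1x * (norm (dx k))\<^sup>2) \<le> (\<rho> * tx k) * wnorm2 (HHx k) (dx k)"
      using rho tx[of k] HHx_lower \<eta>1x_pos by - (rule mult_mono, auto)
    then show ?thesis by (simp add: mult.assoc)
  qed
  have y_descent: "\<rho> * \<gamma> * \<eta>1y * (norm (dy k))\<^sup>2 \<le> \<rho> * ty k * wnorm2 (HHy k) (dy k)" for k
  proof -
    have "(\<rho> * \<gamma>) * (\<eta>1y * (norm (dy k))\<^sup>2) \<le> (\<rho> * ty k) * wnorm2 (HHy k) (dy k)"
      using rho ty[of k] HHy_lower \<eta>1y_pos by - (rule mult_mono, auto)
    then show ?thesis by (simp add: mult.assoc)
  qed
  have x_step: "norm (x (Suc k) - x k) \<le> norm (dx k)" for k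
    using tx[of k] by (simp add: x_Suc mult_left_le_one_le)
  have y_step: "norm (y (Suc k) - y k) \<le> norm (dy k)" for k
    using ty[of k] by (simp add: y_Suc mult_left_le_one_le)

  \<comment> \<open>Curvature of the regularised matrices from above\<close>
  have \<eta>2y: "0 \<le> \<eta>2y"
    using Hy_bound[of 0] spectral_norm_nonneg[of "Hy 0"] beta sigma by (simp add: \<eta>2y_def)
  then have E: "0 \<le> E"
    using \<kappa> by (simp add: E_eq)
  have HHy_upper: "norm (\<kappa> *\<^sub>R (HHy k *v v)) \<le> E * norm v" for k v
  proof -
    have "norm (HHy k *v v) \<le> norm (Hy k *v v) + norm ((\<beta> + \<sigma>) *\<^sub>R v)"
      unfolding HHy_def
      by (simp add: matrix_vector_mult_add_rdistrib scaleR_matrix_vector_assoc[symmetric] norm_triangle_ineq del: norm_scaleR)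
    also have "norm (Hy k *v v) \<le> \<eta>y * norm v"
      using norm_matrix_vector_le_spectral_norm[of "Hy k" v] Hy_bound[of k]
      by (meson mult_right_mono norm_ge_zero order_trans)
    finally have "norm (HHy k *v v) \<le> \<eta>2y * norm v"
      using beta sigma by (simp add: \<eta>2y_def distrib_right)
    then show ?thesis
      using \<kappa> by (simp add: E_eq mult.assoc)
  qed
  define \<eta>2x where "\<eta>2x = \<eta>x + \<beta> * spectral_norm B + l"
  have \<eta>2x: "0 \<le> \<eta>2x"
    using Hx_bound[of 0] spectral_norm_nonneg[of "Hx 0"] B_nonneg beta ell by (simp add: \<eta>2x_def)
  have HHx_upper: "norm (HHx k *v v) \<le> \<eta>2x * norm v" for k v
  proof -
    have "HHx k *v v = Hx k *v v + \<beta> *\<^sub>R (B *v v) + l *\<^sub>R v"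
      by (simp add: HHx_def B_def matrix_vector_mult_add_rdistrib scaleR_matrix_vector_assoc[symmetric])
    then have "norm (HHx k *v v) \<le> norm (Hx k *v v) + norm (\<beta> *\<^sub>R (B *v v)) + norm (l *\<^sub>R v)"
      by (metis norm_triangle_ineq norm_triangle_le add_right_mono)
    moreover have "norm (Hx k *v v) \<le> \<eta>x * norm v"
      using norm_matrix_vector_le_spectral_norm[of "Hx k" v] Hx_bound[of k]
      by (meson mult_right_mono norm_ge_zero order_trans)
    moreover have "norm (\<beta> *\<^sub>R (B *v v)) \<le> \<beta> * (spectral_norm B * norm v)"
      using beta norm_matrix_vector_le_spectral_norm[of B v] by simp
    ultimately show ?thesis
      using ell by (simp add: \<eta>2x_def algebra_simps)
  qed

  \<comment> \<open>The multiplier difference\<close>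
  have lam_formula: "lam (Suc k) = - grad g (y k) + (\<beta> * (1 - s)) *\<^sub>R (A *v x (Suc k)) - \<beta> *\<^sub>R y k
      + (s * \<beta>) *\<^sub>R y (Suc k) - \<kappa> *\<^sub>R (HHy k *v dy k)" for k
  proof -
    have "lamh k = - grad g (y k) + \<beta> *\<^sub>R (A *v x (Suc k) - y k) - \<kappa> *\<^sub>R (HHy k *v dy k)"
      using grady[of k] by (simp add: algebra_simps add_eq_0_iff)
    then show ?thesis
      unfolding lam_Suc by (simp add: algebra_simps)
  qed
  \<comment> \<open>The formula for the multiplier covers only positive indices, so the differences
    start at index 1; this is also why \<open>z k\<close> below contains \<open>w (Suc k)\<close>.
    The summands are arranged to fit \<open>norm_add6_sq\<close>.\<close>
  have dlam: "lam (Suc (Suc k)) - lam (Suc k) =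
      (grad g (y k) - grad g (y (Suc k)))
      + (\<beta> * (1 - s)) *\<^sub>R (A *v (x (Suc (Suc k)) - x (Suc k)))
      + \<beta> *\<^sub>R (y k - y (Suc k))
      + (s * \<beta>) *\<^sub>R (y (Suc (Suc k)) - y (Suc k))
      + - (\<kappa> *\<^sub>R (HHy (Suc k) *v dy (Suc k)))
      + \<kappa> *\<^sub>R (HHy k *v dy k)" for k
    unfolding lam_formula by (simp add: matrix_vector_mult_diff_distrib algebra_simps)
  have grad_g_step: "norm (grad g (y k) - grad g (y (Suc k))) \<le> Lg * norm (dy k)" for k
  proof -
    have "y j \<in> Sy" for j
      using Sy_seg[of 0 j] by simp
    then have "norm (grad g (y k) - grad g (y (Suc k))) \<le> Lg * norm (y k - y (Suc k))"
      using lipschitz_onD[OF Lg(2)] by (simp add: dist_norm)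
    also have "\<dots> \<le> Lg * norm (dy k)"
      using y_step[of k] Lg by (simp add: norm_minus_commute)
    finally show ?thesis .
  qed
  have y_step': "norm (\<beta> *\<^sub>R (y k - y (Suc k))) \<le> \<beta> * norm (dy k)" for k
    using y_step[of k] beta by (simp add: norm_minus_commute)
  have y_step'': "norm ((s * \<beta>) *\<^sub>R (y (Suc k) - y k)) \<le> \<bar>s\<bar> * \<beta> * norm (dy k)" for k
    using y_step[of k] beta by (simp add: abs_mult mult_left_mono)

  \<comment> \<open>Sufficient descent of the merit function\<close>
  define c where "c = 6 / (\<bar>r + s\<bar> * \<beta>)"
  have c: "0 < c"
    using rs beta by (simp add: c_def)
  define q where "q = merit f g A \<beta> r s \<alpha> Lg \<eta>2y"
  define z where "z k = (w (Suc k), dy k)" for k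
  define a where "a k = norm (dx k) + norm (dy k)" for k
  have q_z: "q (z k) = aug_lag f g A \<beta> (x (Suc k), y (Suc k), lam (Suc k))
      + c * (Lg\<^sup>2 + \<beta>\<^sup>2 + E\<^sup>2) * (norm (dy k))\<^sup>2" for k
    by (simp add: q_def z_def w_eq c_def E_def)

  have dlam_sq: "(norm (lam (Suc (Suc k)) - lam (Suc k)))\<^sup>2 \<le>
      6 * ((Lg\<^sup>2 + \<beta>\<^sup>2 + E\<^sup>2) * (norm (dy k))\<^sup>2 + (s\<^sup>2 * \<beta>\<^sup>2 + E\<^sup>2) * (norm (dy (Suc k)))\<^sup>2
        + \<beta>\<^sup>2 * (1 - s)\<^sup>2 * lambda_max B * (norm (dx (Suc k)))\<^sup>2)" for k
  proof -
    have x_part: "(norm ((\<beta> * (1 - s)) *\<^sub>R (A *v (x (Suc (Suc k)) - x (Suc k)))))\<^sup>2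
        \<le> \<beta>\<^sup>2 * (1 - s)\<^sup>2 * lambda_max B * (norm (dx (Suc k)))\<^sup>2"
    proof -
      let ?t = "tx (Suc k)"
      have "(norm (A *v (x (Suc (Suc k)) - x (Suc k))))\<^sup>2 = ?t\<^sup>2 * (norm (A *v dx (Suc k)))\<^sup>2"
        by (simp add: x_Suc matrix_vector_mult_scaleR power_mult_distrib)
      also have "\<dots> \<le> (norm (A *v dx (Suc k)))\<^sup>2"
        using tx[of "Suc k"] by (intro mult_left_le_one_le) (auto simp: power_le_one)
      also have "\<dots> \<le> lambda_max B * (norm (dx (Suc k)))\<^sup>2"
        using rayleigh_le_lambda_max[OF symmetric_mat_gram, of A "dx (Suc k)"]
        by (simp add: B_def wnorm2_gram)
      finally have "(\<beta> * (1 - s))\<^sup>2 * (norm (A *v (x (Suc (Suc k)) - x (Suc k))))\<^sup>2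
          \<le> (\<beta> * (1 - s))\<^sup>2 * (lambda_max B * (norm (dx (Suc k)))\<^sup>2)"
        by (intro mult_left_mono) auto
      then show ?thesis
        by (simp add: power_mult_distrib mult.assoc)
    qed
    have sq: "(norm v)\<^sup>2 \<le> b\<^sup>2 * n\<^sup>2" if "norm v \<le> b * n" for v :: "real^'n2" and b n
      using power_mono[OF that, of 2] by (simp add: power_mult_distrib)
    show ?thesis
      unfolding dlam
      using norm_add6_sq[of "grad g (y k) - grad g (y (Suc k))"
          "(\<beta> * (1 - s)) *\<^sub>R (A *v (x (Suc (Suc k)) - x (Suc k)))" "\<beta> *\<^sub>R (y k - y (Suc k))"
          "(s * \<beta>) *\<^sub>R (y (Suc (Suc k)) - y (Suc k))" "- (\<kappa> *\<^sub>R (HHy (Suc k) *v dy (Suc k)))"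
          "\<kappa> *\<^sub>R (HHy k *v dy k)"]
        sq[OF grad_g_step, of k] x_part sq[OF y_step', of k] sq[OF y_step'', of "Suc k"]
        sq[OF HHy_upper, of "Suc k" "dy (Suc k)"] sq[OF HHy_upper, of k "dy k"]
      unfolding norm_minus_cancel power_mult_distrib power2_abs by (simp add: algebra_simps)
  qed
  have descent: "q (z (Suc k)) + (min \<delta>x \<delta>y / 2) * (a (Suc k))\<^sup>2 \<le> q (z k)" for k
  proof -
    let ?x = "x (Suc (Suc k))" and ?y = "y (Suc k)" and ?y' = "y (Suc (Suc k))"
    let ?X = "(norm (dx (Suc k)))\<^sup>2" and ?Y = "(norm (dy (Suc k)))\<^sup>2" and ?Z = "(norm (dy k))\<^sup>2"
    let ?u = "A *v ?x - ?y" and ?v = "A *v ?x - ?y'"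
    let ?dl = "lam (Suc (Suc k)) - lam (Suc k)"
    have "?dl = - (\<beta> *\<^sub>R (r *\<^sub>R ?u + s *\<^sub>R ?v))"
      unfolding lam_Suc[of "Suc k"] lamh_eq by (simp add: algebra_simps)
    then have dl: "(norm ?dl)\<^sup>2 = \<beta>\<^sup>2 * (norm (r *\<^sub>R ?u + s *\<^sub>R ?v))\<^sup>2"
      by (simp add: power_mult_distrib)
    have uv: "(norm (?u - ?v))\<^sup>2 \<le> ?Y"
      using y_step[of "Suc k"] by (intro power_mono) auto
    have "r * (norm ?u)\<^sup>2 + s * (norm ?v)\<^sup>2
        \<le> ((norm (r *\<^sub>R ?u + s *\<^sub>R ?v))\<^sup>2 + \<bar>r * s\<bar> * (norm (?u - ?v))\<^sup>2) / \<bar>r + s\<bar>"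
      using rs by (rule weighted_norm_sq_sum_le)
    also have "\<dots> \<le> ((norm (r *\<^sub>R ?u + s *\<^sub>R ?v))\<^sup>2 + \<bar>r * s\<bar> * ?Y) / \<bar>r + s\<bar>"
      using uv by (intro divide_right_mono add_left_mono mult_left_mono) auto
    finally have "\<beta> * (r * (norm ?u)\<^sup>2 + s * (norm ?v)\<^sup>2)
        \<le> \<beta> * (((norm (r *\<^sub>R ?u + s *\<^sub>R ?v))\<^sup>2 + \<bar>r * s\<bar> * ?Y) / \<bar>r + s\<bar>)"
      using beta by (intro mult_left_mono) auto
    \<comment> \<open>Since \<open>?dl\<close> is \<open>- \<beta>\<close> times the combination of
      the residuals, the factor \<open>\<beta> / \<bar>r + s\<bar>\<close> becomes
      \<open>1 / (\<bar>r + s\<bar> * \<beta>) = c / 6\<close>; the six of \<open>dlam_sq\<close>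
      then restores \<open>c\<close>.\<close>
    also have "\<dots> = c / 6 * (norm ?dl)\<^sup>2 + \<bar>r * s\<bar> * \<beta> / \<bar>r + s\<bar> * ?Y"
      unfolding dl c_def using rs beta by (simp add: field_simps power2_eq_square)
    also have "c / 6 * (norm ?dl)\<^sup>2 \<le> c / 6 *
      (6 * ((Lg\<^sup>2 + \<beta>\<^sup>2 + E\<^sup>2) * ?Z + (s\<^sup>2 * \<beta>\<^sup>2 + E\<^sup>2) * ?Y + \<beta>\<^sup>2 * (1 - s)\<^sup>2 * lambda_max B * ?X))"
      using c by (intro mult_left_mono dlam_sq) auto
    finally have increase: "r * \<beta> * (norm ?u)\<^sup>2 + s * \<beta> * (norm ?v)\<^sup>2 \<le>
      c * ((Lg\<^sup>2 + \<beta>\<^sup>2 + E\<^sup>2) * ?Z + (s\<^sup>2 * \<beta>\<^sup>2 + E\<^sup>2) * ?Y + \<beta>\<^sup>2 * (1 - s)\<^sup>2 * lambda_max B * ?X)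
      + \<bar>r * s\<bar> * \<beta> / \<bar>r + s\<bar> * ?Y"
      by (simp add: algebra_simps)
    have decrease: "aug_lag f g A \<beta> (?x, ?y', lam (Suc (Suc k)))
        \<le> aug_lag f g A \<beta> (x (Suc k), ?y, lam (Suc k)) - \<rho> * \<gamma> * \<eta>1x * ?X - \<rho> * \<gamma> * \<eta>1y * ?Y
          + (r * \<beta> * (norm ?u)\<^sup>2 + s * \<beta> * (norm ?v)\<^sup>2)"
      using x_armijo[of "Suc k"] y_armijo[of "Suc k"] x_descent[of "Suc k"] y_descent[of "Suc k"]
        aug_lag_multiplier_change[of f g A \<beta> ?x ?y "lam (Suc k)" "r * \<beta>"]
        aug_lag_multiplier_change[of f g A \<beta> ?x ?y' "lamh (Suc k)" "s * \<beta>"]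
      unfolding lam_Suc[of "Suc k", symmetric] lamh_eq[of "Suc k", symmetric] by linarith
    have \<delta>x_eq: "\<delta>x = \<rho> * \<gamma> * \<eta>1x - c * (\<beta>\<^sup>2 * (1 - s)\<^sup>2 * lambda_max B)"
      unfolding \<delta>x_def c_def B_def using rs beta by (simp add: field_simps power2_eq_square)
    have \<delta>y_eq: "\<delta>y = \<rho> * \<gamma> * \<eta>1y - c * (Lg\<^sup>2 + (1 + s\<^sup>2) * \<beta>\<^sup>2 + 2 * E\<^sup>2)
        - \<bar>r * s\<bar> * \<beta> / \<bar>r + s\<bar>"
      by (simp add: \<delta>y_def c_def E_def)
    \<comment> \<open>The \<open>?Z\<close> term of the increase has exactly the merit coefficient
      and is absorbed by \<open>q (z k)\<close>. The merit term of \<open>z (Suc k)\<close> joins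
      the \<open>?Y\<close> terms and produces the constant in \<open>\<delta>y\<close>.\<close>
    have "q (z (Suc k)) + \<delta>x * ?X + \<delta>y * ?Y \<le> q (z k)"
      unfolding q_z \<delta>x_eq \<delta>y_eq using decrease increase
      by (simp add: algebra_simps del: aug_lag.simps)
    moreover have "min \<delta>x \<delta>y / 2 * (a (Suc k))\<^sup>2 \<le> \<delta>x * ?X + \<delta>y * ?Y"
    proof -
      have "(a (Suc k))\<^sup>2 \<le> 2 * (?X + ?Y)"
        using zero_le_power2[of "norm (dx (Suc k)) - norm (dy (Suc k))"]
        by (simp add: a_def power2_eq_square algebra_simps)
      then have "min \<delta>x \<delta>y / 2 * (a (Suc k))\<^sup>2 \<le> min \<delta>x \<delta>y / 2 * (2 * (?X + ?Y))"
        using \<delta>x_pos \<delta>y_pos by (intro mult_left_mono) auto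
      also have "\<dots> = min \<delta>x \<delta>y * ?X + min \<delta>x \<delta>y * ?Y"
        by (simp add: algebra_simps)
      also have "\<dots> \<le> \<delta>x * ?X + \<delta>y * ?Y"
        by (intro add_mono mult_right_mono) auto
      finally show ?thesis .
    qed
    ultimately show ?thesis by linarith
  qed

  \<comment> \<open>Bounds on the gradient of the merit function and on the steps\<close>
  define \<omega> where "\<omega> = spectral_norm A"
  have \<omega>: "0 \<le> \<omega>"
    by (simp add: \<omega>_def spectral_norm_nonneg)
  define T where "T k = a (Suc k) + a k" for k
  have T: "norm (dx (Suc k)) \<le> T k" "norm (dy (Suc k)) \<le> T k" "norm (dy k) \<le> T k" "0 \<le> T k" for k
    by (simp_all add: T_def a_def)
  have Ax_step: "norm (A *v (x (Suc (Suc k)) - x (Suc k))) \<le> \<omega> * T k" for k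
    using norm_matrix_vector_le_spectral_norm[of A "x (Suc (Suc k)) - x (Suc k)"]
      x_step[of "Suc k"] T(1)[of k] \<omega> unfolding \<omega>_def[symmetric]
    by (meson mult_left_mono order_trans)
  define D where "D = Lg + \<beta> * \<bar>1 - s\<bar> * \<omega> + \<beta> + \<bar>s\<bar> * \<beta> + E + E"
  have D: "0 \<le> D"
    using Lg beta \<omega> E by (simp add: D_def)
  have lam_step: "norm (lam (Suc (Suc k)) - lam (Suc k)) \<le> D * T k" for k
  proof -
    have scale: "norm v \<le> b * T k" if "norm v \<le> b * n" "n \<le> T k" "0 \<le> b" for v :: "real^'n2" and b n
      using that by (meson mult_left_mono order_trans)
    have x_part: "norm ((\<beta> * (1 - s)) *\<^sub>R (A *v (x (Suc (Suc k)) - x (Suc k)))) \<le> \<beta> * \<bar>1 - s\<bar> * (\<omega> * T k)"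
      using Ax_step[of k] beta by (simp add: abs_mult mult_left_mono)
    have neg: "norm (- (\<kappa> *\<^sub>R (HHy (Suc k) *v dy (Suc k)))) \<le> E * T k"
      using scale[OF HHy_upper T(2) E] by simp
    have "norm (lam (Suc (Suc k)) - lam (Suc k)) \<le> Lg * T k + \<beta> * \<bar>1 - s\<bar> * (\<omega> * T k) + \<beta> * T k
        + \<bar>s\<bar> * \<beta> * T k + E * T k + E * T k"
      unfolding dlam using Lg beta E
      by (intro norm_triangle_mono x_part neg scale[OF grad_g_step T(3)] scale[OF y_step' T(3)]
          scale[OF y_step'' T(2)] scale[OF HHy_upper T(3)]) auto
    then show ?thesis
      by (simp add: D_def algebra_simps)
  qed
  define U where "U = (\<bar>s\<bar> + D / \<beta>) / \<bar>r + s\<bar>"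
  have U: "0 \<le> U"
    using D beta by (simp add: U_def)
  have u_bound: "norm (A *v x (Suc (Suc k)) - y (Suc k)) \<le> U * T k" for k
  proof -
    let ?u = "A *v x (Suc (Suc k)) - y (Suc k)" and ?e = "y (Suc (Suc k)) - y (Suc k)"
    let ?dl = "lam (Suc (Suc k)) - lam (Suc k)"
    \<comment> \<open>The residual after the y-update is \<open>?u - ?e\<close>. Substituting it
      into the multiplier update leaves one unknown residual, which \<open>r + s \<noteq> 0\<close>
      allows to isolate.\<close>
    have "(r + s) *\<^sub>R ?u = s *\<^sub>R ?e - (1 / \<beta>) *\<^sub>R ?dl"
      unfolding lam_Suc[of "Suc k"] lamh_eq using beta by (simp add: algebra_simps)
    then have "\<bar>r + s\<bar> * norm ?u = norm (s *\<^sub>R ?e - (1 / \<beta>) *\<^sub>R ?dl)"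
      by (metis norm_scaleR)
    also have "\<dots> \<le> \<bar>s\<bar> * norm ?e + 1 / \<beta> * norm ?dl"
      using norm_triangle_ineq4[of "s *\<^sub>R ?e" "(1 / \<beta>) *\<^sub>R ?dl"] beta by simp
    also have "\<dots> \<le> \<bar>s\<bar> * T k + 1 / \<beta> * (D * T k)"
      using lam_step[of k] y_step[of "Suc k"] T(2)[of k] beta
      by (intro add_mono mult_left_mono) auto
    finally show ?thesis
      using rs by (simp add: U_def field_simps)
  qed
  define cd where "cd = 2 * (c * (Lg\<^sup>2 + \<beta>\<^sup>2 + E\<^sup>2))"
  have cd: "0 \<le> cd"
    using c by (simp add: cd_def)
  \<comment> \<open>One constant for both the gradient and the step bound. In \<open>D + 4\<close>,
    two units pay for the steps in x and y and two for the difference of consecutive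
    \<open>dy\<close>.\<close>
  define C where "C = \<kappa> * \<eta>2x + (E + \<bar>r\<bar> * \<beta> * U + \<beta> * \<omega>) + (U + \<omega>) + cd + D + 4"
  have "0 \<le> \<kappa> * \<eta>2x" "0 \<le> \<bar>r\<bar> * \<beta> * U" "0 \<le> \<beta> * \<omega>"
    using \<kappa> \<eta>2x beta U \<omega> by auto
  then have C: "0 \<le> C" "D + 4 \<le> C" "\<kappa> * \<eta>2x + (E + \<bar>r\<bar> * \<beta> * U + \<beta> * \<omega>) + (U + \<omega>) + cd \<le> C"
    using E U \<omega> cd D by (simp_all add: C_def)
  have grad_bound: "norm (grad q (z k)) \<le> C * T k" for k
  proof -
    let ?x = "x (Suc k)" and ?y = "y (Suc k)" and ?l = "lam (Suc k)"
    let ?u = "A *v x (Suc (Suc k)) - ?y" and ?Ax = "A *v (x (Suc (Suc k)) - ?x)"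
    let ?gx = "grad f ?x - transpose A *v ?l + \<beta> *\<^sub>R (transpose A *v (A *v ?x - ?y))"
    let ?gy = "grad g ?y + ?l - \<beta> *\<^sub>R (A *v ?x - ?y)"
    have "norm (HHx (Suc k) *v dx (Suc k)) \<le> \<eta>2x * T k"
      using HHx_upper[of "Suc k" "dx (Suc k)"] T(1)[of k] \<eta>2x by (meson mult_left_mono order_trans)
    then have gx: "norm ?gx \<le> \<kappa> * \<eta>2x * T k"
      unfolding gradx using \<kappa> by simp
    have res: "A *v ?x - ?y = ?u - ?Ax"
      by (simp add: matrix_vector_mult_diff_distrib)
    have gl: "norm (A *v ?x - ?y) \<le> (U + \<omega>) * T k"
      unfolding res using norm_triangle_ineq4[of ?u ?Ax] u_bound[of k] Ax_step[of k]
      by (simp add: algebra_simps)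
    \<comment> \<open>The optimality condition \<open>grady\<close> holds at the next x-iterate and
      the intermediate multiplier. Passing back to the previous x-iterate and multiplier costs a
      multiple of \<open>?u\<close> and of \<open>?Ax\<close>.\<close>
    have "?gy = (grad g ?y + lamh (Suc k) - \<beta> *\<^sub>R ?u) + (r * \<beta>) *\<^sub>R ?u + \<beta> *\<^sub>R ?Ax"
      unfolding lamh_eq by (simp add: matrix_vector_mult_diff_distrib algebra_simps)
    then have gy_eq: "?gy = - (\<kappa> *\<^sub>R (HHy (Suc k) *v dy (Suc k))) + (r * \<beta>) *\<^sub>R ?u + \<beta> *\<^sub>R ?Ax"
      unfolding grady .
    have "norm (\<kappa> *\<^sub>R (HHy (Suc k) *v dy (Suc k))) \<le> E * T k"
      using HHy_upper[of "Suc k" "dy (Suc k)"] T(2)[of k] E by (meson mult_left_mono order_trans)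
    then have "norm (- (\<kappa> *\<^sub>R (HHy (Suc k) *v dy (Suc k)))) \<le> E * T k"
      by simp
    moreover have "norm ((r * \<beta>) *\<^sub>R ?u) \<le> \<bar>r\<bar> * \<beta> * (U * T k)"
      using u_bound[of k] beta by (simp add: abs_mult mult_left_mono)
    moreover have "norm (\<beta> *\<^sub>R ?Ax) \<le> \<beta> * (\<omega> * T k)"
      using Ax_step[of k] beta by simp
    ultimately have "norm ?gy \<le> E * T k + \<bar>r\<bar> * \<beta> * (U * T k) + \<beta> * (\<omega> * T k)"
      unfolding gy_eq by (intro norm_triangle_mono)
    then have gy: "norm ?gy \<le> (E + \<bar>r\<bar> * \<beta> * U + \<beta> * \<omega>) * T k"
      by (simp only: distrib_right mult.assoc)
    have gd: "norm (cd *\<^sub>R dy k) \<le> cd * T k"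
      using T(3)[of k] cd by (simp add: mult_left_mono)
    have grad_eq: "grad q (z k) = ((?gx, ?gy, - (A *v ?x - ?y)), cd *\<^sub>R dy k)"
      unfolding q_def z_def w_eq grad_merit[OF f_C1 g_C1] by (simp add: cd_def c_def E_def)
    have "norm (grad q (z k)) \<le> norm ?gx + norm ?gy + norm (A *v ?x - ?y) + norm (cd *\<^sub>R dy k)"
      using norm_Pair_le[of "(?gx, ?gy, - (A *v ?x - ?y))" "cd *\<^sub>R dy k"]
        norm_Pair_le[of ?gx "(?gy, - (A *v ?x - ?y))"] norm_Pair_le[of ?gy "- (A *v ?x - ?y)"]
      unfolding grad_eq norm_minus_cancel by linarith
    also have "\<dots> \<le> (\<kappa> * \<eta>2x + (E + \<bar>r\<bar> * \<beta> * U + \<beta> * \<omega>) + (U + \<omega>) + cd) * T k"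
      using gx gy gl gd unfolding distrib_right by linarith
    also have "\<dots> \<le> C * T k"
      using C(3) T(4) by (intro mult_right_mono)
    finally show ?thesis .
  qed
  have w_step: "norm (w (Suc (Suc k)) - w (Suc k)) \<le> (D + 2) * T k" for k
  proof -
    have "norm (w (Suc (Suc k)) - w (Suc k)) \<le> norm (x (Suc (Suc k)) - x (Suc k))
        + (norm (y (Suc (Suc k)) - y (Suc k)) + norm (lam (Suc (Suc k)) - lam (Suc k)))"
      unfolding w_eq diff_Pair by (meson add_left_mono norm_Pair_le order_trans)
    then show ?thesis
      using x_step[of "Suc k"] y_step[of "Suc k"] lam_step[of k] T(1,2)[of k]
      by (simp add: algebra_simps)
  qed
  have z_step: "norm (z (Suc k) - z k) \<le> C * T k" for k
  proof -
    have "norm (z (Suc k) - z k) \<le> norm (w (Suc (Suc k)) - w (Suc k)) + norm (dy (Suc k) - dy k)"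
      unfolding z_def diff_Pair by (rule norm_Pair_le)
    also have "\<dots> \<le> (D + 4) * T k"
      using w_step[of k] norm_triangle_ineq4[of "dy (Suc k)" "dy k"] T(2,3)[of k]
      by (simp add: algebra_simps)
    also have "\<dots> \<le> C * T k"
      using C(2) T(4) by (intro mult_right_mono)
    finally show ?thesis .
  qed

  \<comment> \<open>Convergence and the KKT conditions\<close>
  have "bounded (range z)"
  proof -
    \<comment> \<open>The direction is the difference of the two endpoints of the segment, at
      parameters 1 and 0, and both lie in the compact set \<open>Sy\<close>.\<close>
    have "dy k \<in> (\<lambda>(u, v). u - v) ` (Sy \<times> Sy)" for k
      using Sy_seg[of 0 k] Sy_seg[of 1 k] by (intro image_eqI[of _ _ "(y k + dy k, y k)"]) auto
    moreover have "compact ((\<lambda>(u, v). u - v) ` (Sy \<times> Sy))"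
      unfolding case_prod_unfold
      by (intro compact_continuous_image compact_Times Sy_compact continuous_intros)
    ultimately have "bounded (range dy)"
      by (meson bounded_subset compact_imp_bounded image_subsetI)
    then show ?thesis
      by (rule bounded_subset[OF bounded_Times[OF w_bounded]]) (auto simp: z_def)
  qed
  then obtain p \<theta> where \<theta>: "strict_mono (\<theta> :: nat \<Rightarrow> nat)" and p: "(z \<circ> \<theta>) \<longlonglongrightarrow> p"
    using bounded_imp_convergent_subsequence by blast
  have q_KL: "KL_property q p" and q_C1: "C1_fun q"
    using KL unfolding KL_function_def q_def by blast+
  then have q_cont: "isCont q p"
    by (meson C1_fun_def gderiv_def has_derivative_continuous)
  have a_nonneg: "0 \<le> a k" for k
    by (simp add: a_def)
  have sum_a: "summable a"
    using q_KL q_cont \<theta> p a_nonneg _ C(1) descent grad_bound[unfolded T_def] z_step[unfolded T_def]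
    by (rule KL_finite_length) (use \<delta>x_pos \<delta>y_pos in auto)
  have sum_T: "summable T"
    unfolding T_def[abs_def] using sum_a by (intro summable_add) (auto simp: summable_Suc_iff)
  have "summable (\<lambda>k. norm (w (Suc (Suc k)) - w (Suc k)))"
    by (rule summable_comparison_test'[OF summable_mult[OF sum_T, of "D + 2"], of 0]) (use w_step in auto)
  then have sum_w: "summable (\<lambda>k. norm (w (Suc k) - w k))"
    using summable_Suc_iff[of "\<lambda>k. norm (w (Suc k) - w k)"] by simp
  then have "summable (\<lambda>k. w (Suc k) - w k)"
    by (rule summable_norm_cancel)
  then obtain S where "(\<lambda>n. \<Sum>k<n. w (Suc k) - w k) \<longlonglongrightarrow> S"
    unfolding summable_def sums_def by blast
  then have "(\<lambda>n. w n - w 0) \<longlonglongrightarrow> S"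
    unfolding sum_lessThan_telescope .
  from tendsto_add[OF this tendsto_const[of "w 0"]] have "w \<longlonglongrightarrow> S + w 0"
    by simp
  then obtain xs ys lams where w_lim: "w \<longlonglongrightarrow> (xs, ys, lams)"
    by (metis prod_cases3)
  have "dy \<longlonglongrightarrow> 0"
    using summable_LIMSEQ_zero[OF sum_a]
    by (rule Lim_null_comparison[rotated]) (simp add: a_def)
  then have "z \<longlonglongrightarrow> ((xs, ys, lams), 0)"
    unfolding z_def[abs_def] using w_lim by (intro tendsto_Pair LIMSEQ_Suc)
  then have "(\<lambda>k. grad q (z k)) \<longlonglongrightarrow> grad q ((xs, ys, lams), 0)"
    using q_C1 by (auto simp: C1_fun_def continuous_on_eq_continuous_at intro: isCont_tendsto_compose)
  moreover have "(\<lambda>k. grad q (z k)) \<longlonglongrightarrow> 0"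
    using grad_bound summable_LIMSEQ_zero[OF summable_mult[OF sum_T, of C]]
    by (intro Lim_null_comparison[of "\<lambda>k. grad q (z k)"]) auto
  ultimately have "grad q ((xs, ys, lams), 0) = 0"
    by (rule LIMSEQ_unique)
  \<comment> \<open>The third component is feasibility; with it the penalty terms of the first two
    vanish and the remaining KKT equations appear.\<close>
  then have zero: "grad f xs - transpose A *v lams + \<beta> *\<^sub>R (transpose A *v (A *v xs - ys)) = 0"
    "grad g ys + lams - \<beta> *\<^sub>R (A *v xs - ys) = 0" "- (A *v xs - ys) = 0"
    unfolding q_def grad_merit[OF f_C1 g_C1] by (simp_all only: zero_prod_def prod.inject)
  have "GDERIV (aug_lag f g A \<beta>) (xs, ys, lams) :> 0"
    using GDERIV_aug_lag[OF f_C1 g_C1, of A \<beta> xs ys lams] unfolding zero by (simp only: zero_prod_def)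
  moreover have "KKT_point f g A xs ys lams"
    using zero by (simp add: KKT_point_def add_eq_0_iff2)
  ultimately show ?thesis
    using sum_w w_lim by blast
qed

end
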